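(* Let $\lambda\in P^+$. There exists an involution $\rho_\lambda:\mathcal T(\lambda)\to\mathcal T(\lambda)$ such that (with the convention $\rho_\lambda(0)=0$), for all $k\ge0$ and $i_1,\dots,i_k\in I$, $$\rho_\lambda\big(\tilde f_{i_k}\cdots\tilde f_{i_1}T^\lambda\big)=\tilde e_{n+1-i_k}\cdots\tilde e_{n+1-i_1}T_\lambda.$$
   Context: Fix $n$, $I=\{1,\dots,n\}$. Let $\epsilon_1,\dots,\epsilon_{n+1}$ be the standard basis of $\mathbb R^{n+1}$, $\omega_i=\epsilon_1+\dots+\epsilon_i$, $P^+=\bigoplus_{i\in I}\mathbb Z_{\ge0}\omega_i$. Write $\lambda=\sum_{i=1}^n a_i\omega_i$ and $\lambda_i=\sum_{j=i}^n a_j$; identify $\lambda$ with the Young diagram with rows $\lambda_1\ge\dots\ge\lambda_n$. $\mathcal T(\lambda)$ is the set of semistandard Young tableaux of shape $\lambda$ with entries in $\{1,\dots,n+1\}$ (rows weakly increasing, columns strictly increasing). Operators $\tilde e_i,\tilde f_i:\mathcal T(\lambda)\to\mathcal T(\lambda)\cup\{0\}$ (extended by $0\mapsto0$): read the boxes by the Far-Eastern reading (columns from right to left, each column from top to bottom); write $+$ for each entry $i$ and $-$ for each entry $i+1$; cancel successively all pairs $(+,-)$ ($+$ before $-$); the remaining sequence of $-$'s followed by $+$'s is the $i$-signature. $\tilde f_iT$ changes $i$ to $i+1$ in the box of the leftmost $+$ ($0$ if there is none); $\tilde e_iT$ changes $i+1$ to $i$ in the box of the rightmost $-$ ($0$ if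 there is none). $T^\lambda\in\mathcal T(\lambda)$ is the tableau whose $k$-th row is filled with $k$; $T_\lambda\in\mathcal T(\lambda)$ is the tableau whose $k$-th column, read from bottom to top, is $n+1,n,\dots,n+2-c_k$, where $c_k$ is the length of the $k$-th column of $\lambda$. *)

theory Defs
  imports Complex_Main
begin

text \<open>
  Vectors in \<open>\<real>\<^sup>n\<^sup>+\<^sup>1\<close> are functions \<open>nat \<Rightarrow> real\<close> vanishing outside the
  index range \<open>{1..n+1}\<close>; all indices (coordinates, rows, columns, entries) start at 1.
\<close>

definition eps :: "nat \<Rightarrow> nat \<Rightarrow> real" where
  "eps i = (\<lambda>x. if x = i then 1 else 0)"

definition omega :: "nat \<Rightarrow> nat \<Rightarrow> real" where
  "omega i = (\<lambda>x. \<Sum>k = 1..i. eps k x)"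

definition Pplus :: "nat \<Rightarrow> (nat \<Rightarrow> real) set" where
  "Pplus n = {lam. \<exists>a :: nat \<Rightarrow> nat. lam = (\<lambda>x. \<Sum>i = 1..n. real (a i) * omega i x)}"

lemma weight_coordinate:
  fixes a :: "nat \<Rightarrow> nat"
  assumes "1 \<le> r"
  shows "(\<Sum>i = 1..n. real (a i) * omega i r) = real (\<Sum>j = r..n. a j)"
proof -
  have om: "omega i r = (if r \<le> i then 1 else 0)" for i
    using assms by (simp add: omega_def eps_def)
  have "(\<Sum>i = 1..n. real (a i) * omega i r) = (\<Sum>i\<in>{1..n}. if r \<le> i then real (a i) else 0)"
    by (simp add: om if_distrib cong: if_cong)
  also have "\<dots> = (\<Sum>i\<in>{i \<in> {1..n}. r \<le> i}. real (a i))"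
    by (intro sum.inter_filter [symmetric]) simp
  also have "{i \<in> {1..n}. r \<le> i} = {r..n}"
    using assms by auto
  finally show ?thesis by simp
qed

text \<open>A box is a pair (row, column). By the lemma above, row \<open>r\<close> has
  \<open>lam r = a r + \<dots> + a n\<close> boxes.\<close>

type_synonym box = "nat \<times> nat"

definition diagram :: "(nat \<Rightarrow> real) \<Rightarrow> box set" where
  "diagram lam = {(r, c). 1 \<le> r \<and> 1 \<le> c \<and> real c \<le> lam r}"

definition row_len :: "(nat \<Rightarrow> real) \<Rightarrow> nat \<Rightarrow> nat" where
  "row_len lam r = card {c. (r, c) \<in> diagram lam}"

definition col_len :: "(nat \<Rightarrow> real) \<Rightarrow> nat \<Rightarrow> nat" where
  "col_len lam c = card {r. (r, c) \<in> diagram lam}"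

text \<open>Tableaux take the dummy value 0 outside the diagram, so that equality of functions is
  equality of tableaux.\<close>

type_synonym tableau = "box \<Rightarrow> nat"

definition tableaux :: "nat \<Rightarrow> (nat \<Rightarrow> real) \<Rightarrow> tableau set" where
  "tableaux n lam = {T.
     (\<forall>b \<in> diagram lam. T b \<in> {1..n+1}) \<and>
     (\<forall>b. b \<notin> diagram lam \<longrightarrow> T b = 0) \<and>
     (\<forall>r c c'. (r, c) \<in> diagram lam \<and> (r, c') \<in> diagram lam \<and> c < c' \<longrightarrow> T (r, c) \<le> T (r, c')) \<and>
     (\<forall>r r' c. (r, c) \<in> diagram lam \<and> (r', c) \<in> diagram lam \<and> r < r' \<longrightarrow> T (r, c) < T (r', c))}"

definition far_eastern :: "(nat \<Rightarrow> real) \<Rightarrow> box list" where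
  "far_eastern lam =
     concat (map (\<lambda>c. map (\<lambda>r. (r, c)) [1..<col_len lam c + 1]) (rev [1..<row_len lam 1 + 1]))"

datatype sign = Plus | Minus

text \<open>The signs are kept together with the boxes they come from.\<close>

definition sign_word :: "(nat \<Rightarrow> real) \<Rightarrow> nat \<Rightarrow> tableau \<Rightarrow> (box \<times> sign) list" where
  "sign_word lam i T =
     concat (map (\<lambda>b. if T b = i then [(b, Plus)] else if T b = i + 1 then [(b, Minus)] else [])
       (far_eastern lam))"

inductive cancel :: "(box \<times> sign) list \<Rightarrow> (box \<times> sign) list \<Rightarrow> bool" where
  "cancel (u @ [(b, Plus), (b', Minus)] @ v) (u @ v)"

fun cancel_cons :: "box \<times> sign \<Rightarrow> (box \<times> sign) list \<Rightarrow> (box \<times> sign) list" where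
  "cancel_cons (b, Plus) ((b', Minus) # w) = w"
| "cancel_cons x w = x # w"

definition reduced_word :: "(box \<times> sign) list \<Rightarrow> (box \<times> sign) list" where
  "reduced_word w = foldr cancel_cons w []"

text \<open>\<open>reduced_word\<close> computes the result of cancelling pairs \<open>(Plus, Minus)\<close>
  until none is left, in whatever order: it is the unique normal form of \<open>cancel\<close>.\<close>

lemma cancel_Cons: "cancel w w' \<Longrightarrow> cancel (x # w) (x # w')"
proof (induction rule: cancel.induct)
  case (1 u b b' v)
  show ?case using cancel.intros[of "x # u" b b' v] by simp
qed

lemma cancels_Cons: "cancel\<^sup>*\<^sup>* w w' \<Longrightarrow> cancel\<^sup>*\<^sup>* (x # w) (x # w')"
  by (induction rule: rtranclp_induct) (auto intro: cancel_Cons rtranclp.rtrancl_into_rtrancl)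

lemma cancels_reduced_word: "cancel\<^sup>*\<^sup>* w (reduced_word w)"
proof (induction w)
  case Nil
  show ?case by (simp add: reduced_word_def)
next
  case (Cons x w)
  have "cancel\<^sup>*\<^sup>* (x # w) (x # reduced_word w)"
    using Cons by (rule cancels_Cons)
  moreover have "cancel\<^sup>*\<^sup>* (x # y) (cancel_cons x y)" for y
    using cancel.intros[of "[]"] by (cases "(x, y)" rule: cancel_cons.cases) auto
  ultimately show ?case
    by (simp add: reduced_word_def) (meson rtranclp_trans)
qed

lemma reduced_word_cancel: "cancel w w' \<Longrightarrow> reduced_word w = reduced_word w'"
  by (induction rule: cancel.induct) (simp add: reduced_word_def)

lemma reduced_word_irreducible:
  assumes "\<nexists>w'. cancel w w'"
  shows "reduced_word w = w"
  using cancels_reduced_word[of w] assms by (metis converse_rtranclpE)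

lemma reduced_word_form:
  "\<exists>p q. reduced_word w = p @ q \<and> (\<forall>x \<in> set p. snd x = Minus) \<and> (\<forall>x \<in> set q. snd x = Plus)"
proof (induction w)
  case Nil
  show ?case by (simp add: reduced_word_def)
next
  case (Cons x w)
  then obtain p q where pq: "reduced_word w = p @ q"
    "\<forall>x \<in> set p. snd x = Minus" "\<forall>x \<in> set q. snd x = Plus" by blast
  have step: "reduced_word (x # w) = cancel_cons x (p @ q)"
    using pq(1) by (simp add: reduced_word_def)
  obtain b s where x: "x = (b, s)" by (cases x)
  show ?case
  proof (cases s)
    case Minus
    then show ?thesis using step pq x
      by (intro exI[of _ "x # p"] exI[of _ q]) simp
  next
    case Plus
    show ?thesis
    proof (cases p)
      case Nil
      have "cancel_cons x q = x # q"
        using pq(3) x Plus by (cases q) auto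
      then show ?thesis using step pq x Plus Nil
        by (intro exI[of _ "[]"] exI[of _ "x # q"]) simp
    next
      case (Cons y p')
      obtain b' where "y = (b', Minus)" using pq(2) Cons by (cases y) auto
      then show ?thesis using step pq x Plus Cons
        by (intro exI[of _ p'] exI[of _ q]) simp
    qed
  qed
qed

theorem reduced_word_unique:
  "cancel\<^sup>*\<^sup>* w v \<and> (\<nexists>v'. cancel v v') \<longleftrightarrow> v = reduced_word w"
proof
  assume v: "cancel\<^sup>*\<^sup>* w v \<and> (\<nexists>v'. cancel v v')"
  then have "cancel\<^sup>*\<^sup>* w v" by blast
  then have "reduced_word w = reduced_word v"
    by (induction rule: rtranclp_induct) (auto dest: reduced_word_cancel)
  with v show "v = reduced_word w" using reduced_word_irreducible by metis
next
  assume v: "v = reduced_word w"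
  obtain p q where pq: "reduced_word w = p @ q"
    "\<forall>x \<in> set p. snd x = Minus" "\<forall>x \<in> set q. snd x = Plus"
    using reduced_word_form by blast
  have "\<not> cancel v v'" for v'
  proof
    assume "cancel v v'"
    then obtain s b b' t where st: "v = s @ [(b, Plus), (b', Minus)] @ t"
      by (auto elim: cancel.cases)
    have "sorted_wrt (\<lambda>x y. snd x = Minus \<or> snd y = Plus) v"
      using pq v by (auto simp: nth_append sorted_wrt_iff_nth_less)
    then show False unfolding st by (simp add: sorted_wrt_append)
  qed
  then show "cancel\<^sup>*\<^sup>* w v \<and> (\<nexists>v'. cancel v v')"
    using v cancels_reduced_word by blast
qed

definition signature :: "(nat \<Rightarrow> real) \<Rightarrow> nat \<Rightarrow> tableau \<Rightarrow> (box \<times> sign) list" where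
  "signature lam i T = reduced_word (sign_word lam i T)"

text \<open>\<open>None\<close> plays the role of the extra element 0.\<close>

definition ftilde :: "(nat \<Rightarrow> real) \<Rightarrow> nat \<Rightarrow> tableau \<Rightarrow> tableau option" where
  "ftilde lam i T =
     (let ps = filter (\<lambda>x. snd x = Plus) (signature lam i T)
      in if ps = [] then None else Some (T(fst (hd ps) := i + 1)))"

definition etilde :: "(nat \<Rightarrow> real) \<Rightarrow> nat \<Rightarrow> tableau \<Rightarrow> tableau option" where
  "etilde lam i T =
     (let ms = filter (\<lambda>x. snd x = Minus) (signature lam i T)
      in if ms = [] then None else Some (T(fst (last ms) := i)))"

text \<open>For \<open>is = [i\<^sub>1, \<dots>, i\<^sub>k]\<close> the operator with index \<open>i\<^sub>1\<close> acts first.\<close>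

definition ftildes :: "(nat \<Rightarrow> real) \<Rightarrow> nat list \<Rightarrow> tableau \<Rightarrow> tableau option" where
  "ftildes lam is T = fold (\<lambda>i X. Option.bind X (ftilde lam i)) is (Some T)"

definition etildes :: "(nat \<Rightarrow> real) \<Rightarrow> nat list \<Rightarrow> tableau \<Rightarrow> tableau option" where
  "etildes lam is T = fold (\<lambda>i X. Option.bind X (etilde lam i)) is (Some T)"

definition T_high :: "(nat \<Rightarrow> real) \<Rightarrow> tableau" where
  "T_high lam = (\<lambda>(r, c). if (r, c) \<in> diagram lam then r else 0)"

text \<open>Row \<open>r\<close> lies \<open>col_len lam c - r\<close> steps above the bottom box of column \<open>c\<close>.\<close>

definition T_low :: "nat \<Rightarrow> (nat \<Rightarrow> real) \<Rightarrow> tableau" where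
  "T_low n lam = (\<lambda>(r, c). if (r, c) \<in> diagram lam then n + 1 - (col_len lam c - r) else 0)"

end

theory Submission
  imports Defs "HOL-Library.Multiset"
begin

text \<open>
  The involution is that of Schuetzenberger, obtained here from words instead of from
  evacuation.

  The operators on tableaux act through the Far-Eastern reading, and the signature rule makes sense
  on every word. Reversing a word and replacing each letter \<open>x\<close> by \<open>n + 2 - x\<close> turns the signs
  for \<open>i\<close> into the signs for \<open>n + 1 - i\<close>, with plus and minus exchanged and the order reversed; so
  this operation \<open>dual\<close> exchanges \<open>f\<^sub>i\<close> with \<open>e\<close> of index \<open>n + 1 - i\<close> (\<open>word_f_dual\<close>). It does what
  is wanted, except that the dual of the reading of a tableau is in general not the reading of a
  tableau of the same shape.

  Knuth moves repair this. A Knuth move exchanges two neighbouring letters next to a witness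
  that lies between them in size. Each move is a bijection on all words that commutes with all
  the operators (\<open>word_f_knuth_move\<close>), and any two Yamanouchi words with the same letters are
  linked by such moves (\<open>yamanouchi_connected\<close>). The reading of the highest tableau and the dual
  of the reading of the lowest one both list the columns of the shape, each as \<open>1, 2, \<dots>\<close>, only in
  opposite orders; hence both are Yamanouchi words with the same letters, and some composite \<open>\<kappa>\<close>
  of Knuth moves carries the first to the second.

  Now call \<open>T'\<close> a partner of \<open>T\<close> if the dual of the reading of \<open>T'\<close> is \<open>\<kappa>\<close> of the reading of
  \<open>T\<close>. The lowest tableau is a partner of the highest one, and \<open>f\<^sub>i\<close> on the left matches
  \<open>e\<close> of index \<open>n + 1 - i\<close> on the right, because \<open>\<kappa>\<close> and duality respect the operators and the operators
  preserve semistandardness (\<open>ftilde_tableau\<close>, \<open>etilde_tableau\<close>). Every tableau is reached from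
  the highest one (\<open>tableau_induct\<close>), so every tableau has exactly one partner, and
  \<open>\<rho>\<close> sends \<open>T\<close> to its partner. To see that the relation is symmetric, it suffices again to look
  at the highest tableau: the partner of the lowest tableau has the same letters as the highest one,
  and that determines it.
\<close>

section \<open>The signature rule on words\<close>

text \<open>The numbers of uncancelled minus and plus signs in the \<open>i\<close>-signature of a word. Letters are
added at the front: a new plus cancels the first surviving minus if there is one.\<close>

fun nminus :: "nat \<Rightarrow> nat list \<Rightarrow> nat" where
  "nminus i [] = 0"
| "nminus i (x # w) =
     (if x = i then nminus i w - 1 else if x = Suc i then Suc (nminus i w) else nminus i w)"

fun nplus :: "nat \<Rightarrow> nat list \<Rightarrow> nat" where
  "nplus i [] = 0"
| "nplus i (x # w) = (if x = i \<and> nminus i w = 0 then Suc (nplus i w) else nplus i w)"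

text \<open>The operator \<open>f\<^sub>i\<close> on words. A letter \<open>i\<close> in front is the leftmost surviving plus precisely if no
minus survives behind it.\<close>

fun word_f :: "nat \<Rightarrow> nat list \<Rightarrow> nat list option" where
  "word_f i [] = None"
| "word_f i (x # w) =
     (if x = i \<and> nminus i w = 0 then Some (Suc i # w) else map_option (Cons x) (word_f i w))"

text \<open>Concatenation is a tensor product of crystals: the surviving plus signs of the left factor cancel
against the surviving minus signs of the right factor.\<close>

lemma nminus_append: "nminus i (u @ v) = nminus i u + (nminus i v - nplus i u)"
  by (induction u) auto

lemma nplus_append: "nplus i (u @ v) = nplus i v + (nplus i u - nminus i v)"
  by (induction u) (auto simp: nminus_append)

lemma word_f_append:
  "word_f i (u @ v) =
     (if nplus i u > nminus i v then map_option (\<lambda>u'. u' @ v) (word_f i u)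
      else map_option ((@) u) (word_f i v))"
proof (induction u)
  case Nil
  show ?case by (cases "word_f i v") auto
qed (auto simp: nminus_append option.map_comp comp_def)

lemma word_f_eq_None_iff: "word_f i w = None \<longleftrightarrow> nplus i w = 0"
  by (induction w) auto

text \<open>The changed letter is singled out by two conditions on its surroundings that treat \<open>i\<close> and
\<open>i + 1\<close> alike: no plus survives to its left and no minus to its right. Read from \<open>w'\<close> to
\<open>w\<close>, the equivalence therefore describes the operator \<open>e\<^sub>i\<close> on words.\<close>

lemma word_f_eq_Some_iff:
  "word_f i w = Some w' \<longleftrightarrow>
     (\<exists>u v. w = u @ i # v \<and> w' = u @ Suc i # v \<and> nplus i u = 0 \<and> nminus i v = 0)"
proof
  show "word_f i w = Some w' \<Longrightarrow>
     \<exists>u v. w = u @ i # v \<and> w' = u @ Suc i # v \<and> nplus i u = 0 \<and> nminus i v = 0"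
  proof (induction w arbitrary: w')
    case (Cons x w)
    show ?case
    proof (cases "x = i \<and> nminus i w = 0")
      case True
      with Cons.prems show ?thesis by (intro exI[of _ "[]"] exI[of _ w]) auto
    next
      case False
      with Cons.prems obtain v' where "word_f i w = Some v'" "w' = x # v'" by auto
      with Cons.IH obtain u v where uv: "w = u @ i # v" "v' = u @ Suc i # v"
        "nplus i u = 0" "nminus i v = 0" by blast
      have "nminus i w = nminus i u" using uv by (simp add: nminus_append)
      with False uv \<open>w' = x # v'\<close> show ?thesis
        by (intro exI[of _ "x # u"] exI[of _ v]) auto
    qed
  qed simp
qed (auto simp: word_f_append)

lemma word_f_inj:
  assumes "word_f i w = Some v" "word_f i w' = Some v"
  shows "w = w'"
proof -
  (* Of two candidates for the raised letter, the right one contributes a minus that must be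
     cancelled by a plus in between; but that plus then survives to the left of the right candidate. *)
  have not_twice: False
    if "nplus i (u @ Suc i # m) = 0" "nminus i (m @ Suc i # s) = 0" for u m s
    using that by (auto simp: nplus_append nminus_append)
  from assms obtain u s u' s' where
    us: "w = u @ i # s" "v = u @ Suc i # s" "nplus i u = 0" "nminus i s = 0" and
    us': "w' = u' @ i # s'" "v = u' @ Suc i # s'" "nplus i u' = 0" "nminus i s' = 0"
    unfolding word_f_eq_Some_iff by blast
  from us(2) us'(2) have "u @ Suc i # s = u' @ Suc i # s'" by simp
  then consider "u = u'" "s = s'" | m where "u = u' @ Suc i # m" "s' = m @ Suc i # s"
    | m where "u' = u @ Suc i # m" "s = m @ Suc i # s'"
    by (auto simp: append_eq_append_conv2 append_eq_Cons_conv Cons_eq_append_conv)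
  then show ?thesis
    using us us' not_twice by cases auto
qed

lemma nminus_pos_of_word_f: "word_f i w = Some v \<Longrightarrow> nminus i v > 0"
  by (auto simp: word_f_eq_Some_iff nminus_append)

lemma predecessor_precedes:
  assumes "nminus i (u @ Suc i # v) = 0"
  shows "i \<in> set u"
proof (rule ccontr)
  assume "i \<notin> set u"
  then have "nplus i u = 0" by (induction u) auto
  with assms show False by (simp add: nminus_append)
qed

text \<open>The next two lemmas detect surviving signs: the entries of a segment of the reading other than
\<open>i\<close> and \<open>i + 1\<close> cannot cancel a plus before it or a minus behind it.\<close>

lemma nplus_skip:
  assumes "\<And>x. x \<in> set xs \<Longrightarrow> T x \<noteq> i \<and> T x \<noteq> Suc i"
  shows "nplus i (u @ i # map T xs) > 0"
proof -
  have "nminus i (map T xs) = 0" using assms by (induction xs) auto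
  then show ?thesis by (simp add: nplus_append)
qed

lemma nminus_skip:
  assumes "\<And>x. x \<in> set xs \<Longrightarrow> T x \<noteq> i \<and> T x \<noteq> Suc i"
  shows "nminus i (map T xs @ Suc i # v) > 0"
  using assms by (induction xs) auto

lemma sum_list_word_f: "word_f i w = Some w' \<Longrightarrow> sum_list w' = Suc (sum_list w)"
  by (auto simp: word_f_eq_Some_iff)

section \<open>Reversing and complementing words\<close>

text \<open>Complementation is taken in the alphabet \<open>{1..n + 1}\<close>. On readings of tableaux, this is the
rotation of the tableau by half a turn with complemented entries.\<close>

definition dual :: "nat \<Rightarrow> nat list \<Rightarrow> nat list" where
  "dual n w = rev (map (\<lambda>x. n + 2 - x) w)"

lemma dual_simps [simp]:
  "dual n [] = []" "dual n (x # w) = dual n w @ [n + 2 - x]" "dual n (u @ v) = dual n v @ dual n u"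
  by (simp_all add: dual_def)

lemma mset_dual: "mset (dual n w) = image_mset (\<lambda>x. n + 2 - x) (mset w)"
  by (simp add: dual_def)

lemma dual_concat: "dual n (concat ws) = concat (map (dual n) (rev ws))"
  by (induction ws) simp_all

lemma dual_dual: "set w \<subseteq> {1..n+1} \<Longrightarrow> dual n (dual n w) = w"
  by (induction w) auto

lemma set_dual: "set w \<subseteq> {1..n+1} \<Longrightarrow> set (dual n w) \<subseteq> {1..n+1}"
  by (induction w) auto

text \<open>Complementation turns each \<open>i\<close> into the upper, each \<open>i + 1\<close> into the lower letter of the pair with
index \<open>n + 1 - i\<close>; reversal then makes the cancelling pairs correspond.\<close>

lemma signs_dual:
  assumes "i \<in> {1..n}" "set w \<subseteq> {1..n+1}"
  shows "nminus (n + 1 - i) (dual n w) = nplus i w \<and> nplus (n + 1 - i) (dual n w) = nminus i w"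
  using assms(2)
proof (induction w)
  case (Cons x w)
  have "x \<in> {1..n+1}" using Cons.prems by simp
  with assms(1) have "n + 2 - x = n + 1 - i \<longleftrightarrow> x = Suc i" "n + 2 - x = Suc (n + 1 - i) \<longleftrightarrow> x = i"
    by auto
  moreover have "nminus (n + 1 - i) (dual n w) = nplus i w" "nplus (n + 1 - i) (dual n w) = nminus i w"
    using Cons by auto
  ultimately show ?case
    by (auto simp: nminus_append nplus_append simp del: add_Suc_right One_nat_def add_2_eq_Suc')
qed simp

lemma word_f_dual:
  assumes i: "i \<in> {1..n}" and w: "set w \<subseteq> {1..n+1}" and f: "word_f i w = Some w'"
  shows "word_f (n + 1 - i) (dual n w') = Some (dual n w)"
proof -
  obtain u v where uv: "w = u @ i # v" "w' = u @ Suc i # v" "nplus i u = 0" "nminus i v = 0"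
    using f unfolding word_f_eq_Some_iff by blast
  have "n + 2 - i = Suc (n + 1 - i)" "n + 2 - Suc i = n + 1 - i" using i by auto
  moreover have "nplus (n + 1 - i) (dual n v) = 0" "nminus (n + 1 - i) (dual n u) = 0"
    using signs_dual[OF i] uv w by auto
  ultimately show ?thesis
    unfolding word_f_eq_Some_iff using uv by (intro exI[of _ "dual n v"] exI[of _ "dual n u"]) simp
qed

section \<open>Knuth moves\<close>

text \<open>The predicates say that one letter of a triple lies between the two others, with ties broken as in
the Knuth relations. The Far-Eastern reading is the reverse of the usual column reading, so the
relations are the mirror images of the usual ones.\<close>

definition last_between :: "nat \<Rightarrow> nat \<Rightarrow> nat \<Rightarrow> bool" where
  "last_between a b c \<longleftrightarrow> a < c \<and> c \<le> b \<or> b < c \<and> c \<le> a"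

definition first_between :: "nat \<Rightarrow> nat \<Rightarrow> nat \<Rightarrow> bool" where
  "first_between a b c \<longleftrightarrow> b \<le> a \<and> a < c \<or> c \<le> a \<and> a < b"

text \<open>The move at position \<open>p\<close> is a total function and not a relation between words, so that a chain of
moves can be applied to all words at the same time. The triples that it fixes are the
strictly increasing and the weakly decreasing ones.\<close>

fun knuth_move :: "nat \<Rightarrow> nat list \<Rightarrow> nat list" where
  "knuth_move 0 (a # b # c # w) =
     (if last_between a b c then b # a # c # w
      else if first_between a b c then a # c # b # w else a # b # c # w)"
| "knuth_move (Suc p) (x # w) = x # knuth_move p w"
| "knuth_move p w = w"

lemma mset_knuth_move [simp]: "mset (knuth_move p w) = mset w"
  by (induction p w rule: knuth_move.induct) auto

lemma between_swap:
  "last_between b a c \<longleftrightarrow> last_between a b c"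
  "first_between a c b \<longleftrightarrow> first_between a b c"
  "first_between a b c \<Longrightarrow> \<not> last_between a c b"
  by (auto simp: last_between_def first_between_def)

lemma knuth_move_involution: "knuth_move p (knuth_move p w) = w"
  by (induction p w rule: knuth_move.induct) (auto simp: between_swap)

lemma word_f_Cons3:
 "word_f i (a # b # c # w) =
   (if a = i \<and> nminus i (b # c # w) = 0 then Some (Suc i # b # c # w)
   else if b = i \<and> nminus i (c # w) = 0 then Some (a # Suc i # c # w)
   else if c = i \<and> nminus i w = 0 then Some (a # b # Suc i # w)
   else map_option (\<lambda>v. a # b # c # v) (word_f i w))"
  by (simp add: option.map_comp comp_def)

lemma nminus_swap_last:
  assumes "a < c" "c \<le> b"
  shows "nminus i (b # a # c # w) = nminus i (a # b # c # w)"
  using assms by auto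

lemma nminus_swap_first:
  assumes "b \<le> a" "a < c"
  shows "nminus i (a # c # b # w) = nminus i (a # b # c # w)"
  using assms by auto

text \<open>The next three lemmas treat the three kinds of triples. The case distinctions separate the possible
positions of \<open>i\<close> and \<open>i + 1\<close> among the letters; in each of them, \<open>f\<^sub>i\<close> turns a triple and
its image under the move into a triple and its image under the move.\<close>

lemma word_f_swap_last:
  assumes "a < c" "c \<le> b"
  shows "word_f i (b # a # c # w) = map_option (knuth_move 0) (word_f i (a # b # c # w))"
proof -
  have k: "knuth_move 0 (p # q # r # v) = q # p # r # v" if "p < r" "r \<le> q" for p q r v
    using that by (simp add: last_between_def)
  consider "c = Suc i" "b = Suc i" "a = i" | "c = Suc i" "b = Suc i" "a \<noteq> i"
     | "c = Suc i" "b \<noteq> Suc i" "a = i"| "c = Suc i" "b \<noteq> Suc i" "a \<noteq> i"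
     | "c = i" "b = i" | "c = i" "b \<noteq> i"
     | "c \<noteq> i" "c \<noteq> Suc i" by blast
  then show ?thesis
    using assms by cases
     (auto simp add: word_f_Cons3 option.map_comp comp_def k simp del: knuth_move.simps word_f.simps)
qed

lemma word_f_swap_first:
  assumes "b \<le> a" "a < c"
  shows "word_f i (a # c # b # w) = map_option (knuth_move 0) (word_f i (a # b # c # w))"
proof -
  have k: "knuth_move 0 (p # q # r # v) = p # r # q # v" if "q \<le> p" "p < r" for p q r v
    using that by (simp add: last_between_def first_between_def)
  (* The kind of the triple can change: i, i, i + 1 becomes i + 1, i, i + 1, where the last letter
     is the witness. *)
  have k': "knuth_move 0 (p # q # r # v) = q # p # r # v" if "q < r" "r \<le> p" for p q r v
    using that by (simp add: last_between_def)
  consider "a = i" "b = i" "c = Suc i" | "a = i" "b = i" "c \<noteq> Suc i"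
     | "a = i" "b \<noteq> i" "c = Suc i"| "a = i" "b \<noteq> i" "c \<noteq> Suc i"
     | "a = Suc i" "b = Suc i" | "a = Suc i" "b \<noteq> Suc i"
     | "a \<noteq> i" "a \<noteq> Suc i" by blast
  then show ?thesis
    using assms by cases
     (auto simp add: word_f_Cons3 option.map_comp comp_def k k' simp del: knuth_move.simps word_f.simps)
qed

lemma word_f_monotone_triple:
  assumes "a < b \<and> b < c \<or> c \<le> b \<and> b \<le> a"
  shows "word_f i (a # b # c # w) = map_option (knuth_move 0) (word_f i (a # b # c # w))"
proof -
  have k: "knuth_move 0 (p # q # r # v) = p # q # r # v"
    if "p < q \<and> q < r \<or> r \<le> q \<and> q \<le> p" for p q r v
    using that by (auto simp add: last_between_def first_between_def)
  consider "b = i" "c = Suc i" | "b = i" "c \<noteq> Suc i" "a = i" | "b = i" "c \<noteq> Suc i" "a \<noteq> i"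
     | "b = Suc i" "a = i" | "b = Suc i" "a \<noteq> i"
     | "b \<noteq> i" "b \<noteq> Suc i" by blast
  then show ?thesis
    using assms by cases
     (auto simp add: word_f_Cons3 option.map_comp comp_def k simp del: knuth_move.simps word_f.simps)
qed

text \<open>Since the move is an involution, commutation at a word implies commutation at its image; this
halves the number of orderings to inspect.\<close>

lemma word_f_knuth_swap:
  assumes "knuth_move 0 u = v" "word_f i v = map_option (knuth_move 0) (word_f i u)"
  shows "word_f i u = map_option (knuth_move 0) (word_f i v)"
  using assms by (cases "word_f i u") (auto simp: knuth_move_involution)

lemma nminus_knuth_move [simp]: "nminus i (knuth_move p w) = nminus i w"
proof (induction p w rule: knuth_move.induct)
  case (1 a b c w)
  show ?case
    using nminus_swap_last[of a c b i w] nminus_swap_last[of b c a i w]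
      nminus_swap_first[of b a c i w] nminus_swap_first[of c a b i w]
    unfolding knuth_move.simps last_between_def first_between_def
    by (auto simp del: nminus.simps)
qed auto

text \<open>Only a triple at the front has to be inspected: the operators on a longer word look at the rest
of the word through the number of surviving minus signs alone, which the move preserves.\<close>

lemma word_f_knuth_move:
  "word_f i (knuth_move p w) = map_option (knuth_move p) (word_f i w)"
proof (induction p w rule: knuth_move.induct)
  case (1 a b c w)
  show ?case
  proof (cases "last_between a b c")
    case True
    then have k: "knuth_move 0 (a # b # c # w) = b # a # c # w"
      "knuth_move 0 (b # a # c # w) = a # b # c # w" by (simp_all add: between_swap)
    show ?thesis
      using True word_f_swap_last[of a c b i w] word_f_swap_last[of b c a i w] word_f_knuth_swap[OF k(2)]
      unfolding k last_between_def by blast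
  next
    case False
    show ?thesis
    proof (cases "first_between a b c")
      case True
      then have k: "knuth_move 0 (a # b # c # w) = a # c # b # w"
        "knuth_move 0 (a # c # b # w) = a # b # c # w" using False by (simp_all add: between_swap)
      show ?thesis
        using True word_f_swap_first[of b a c i w] word_f_swap_first[of c a b i w] word_f_knuth_swap[OF k(2)]
        unfolding k first_between_def by blast
    next
      case no_first: False
      have "word_f i (a # b # c # w) = map_option (knuth_move 0) (word_f i (a # b # c # w))"
        using False no_first unfolding last_between_def first_between_def
        by (intro word_f_monotone_triple) linarith
      with False no_first show ?thesis by simp
    qed
  qed
next
  case (2 p x w)
  then show ?case by (auto simp: option.map_comp comp_def)
qed auto

lemma word_f_knuth_moves:
  "word_f i (fold knuth_move ps w) = map_option (fold knuth_move ps) (word_f i w)"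
  by (induction ps arbitrary: w) (simp_all add: word_f_knuth_move option.map_id0 option.map_comp comp_def)

lemma mset_knuth_moves: "mset (fold knuth_move ps w) = mset w"
  by (induction ps arbitrary: w) simp_all

section \<open>Yamanouchi words\<close>

text \<open>The multiplicities form a partition. Index 0 is excluded, since the letters start at 1.\<close>

definition dominant :: "nat multiset \<Rightarrow> bool" where
  "dominant M \<longleftrightarrow> (\<forall>i \<ge> 1. count M (Suc i) \<le> count M i)"

text \<open>Words all of whose prefixes have dominant content. They are the words in positive letters that
all \<open>e\<^sub>i\<close> send to 0, but what matters here is how they grow by single letters.\<close>

inductive yamanouchi :: "nat list \<Rightarrow> bool" where
  Nil: "yamanouchi []"
| snoc: "yamanouchi w \<Longrightarrow> 1 \<le> x \<Longrightarrow> dominant (mset w + {#x#}) \<Longrightarrow> yamanouchi (w @ [x])"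

lemma yamanouchi_dominant: "yamanouchi w \<Longrightarrow> dominant (mset w)"
  by (cases rule: yamanouchi.cases) (auto simp: dominant_def)

lemma yamanouchi_snocD:
  "yamanouchi (w @ [x]) \<Longrightarrow> yamanouchi w \<and> 1 \<le> x \<and> dominant (mset w + {#x#})"
  by (cases rule: yamanouchi.cases) auto

lemma yamanouchi_positive: "yamanouchi w \<Longrightarrow> 0 \<notin> set w"
  by (induction rule: yamanouchi.induct) auto

lemma yamanouchi_exists:
  assumes "dominant M" "0 \<notin># M"
  shows "\<exists>w. yamanouchi w \<and> mset w = M"
  using assms
proof (induction "size M" arbitrary: M)
  case 0
  then show ?case by (auto intro: exI[of _ "[]"] yamanouchi.Nil)
next
  case (Suc k)
  (* Removing the largest letter is removing a corner from the last row. *)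
  define b where "b = Max (set_mset M)"
  have "M \<noteq> {#}" using Suc by auto
  then have b: "b \<in># M" "Suc b \<notin># M"
    unfolding b_def by (auto dest: Max_ge[OF finite_set_mset])
  define N where "N = M - {#b#}"
  have M: "M = N + {#b#}" using b by (simp add: N_def)
  have "count N (Suc i) \<le> count N i" if "1 \<le> i" for i
  proof (cases "i = b")
    case True
    then show ?thesis using b(2) by (simp add: N_def not_in_iff)
  next
    case False
    have "count M (Suc i) \<le> count M i" using Suc.prems(1) that by (simp add: dominant_def)
    with False show ?thesis by (simp add: N_def)
  qed
  then have "dominant N" by (simp add: dominant_def)
  moreover have "size N = k" "0 \<notin># N" using Suc M by auto
  ultimately obtain w where "yamanouchi w" "mset w = N" using Suc by metis
  moreover have "1 \<le> b" using Suc.prems(2) b(1) by (cases b) auto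
  ultimately show ?case using Suc.prems(1) yamanouchi.snoc[of w b] M by auto
qed

text \<open>Appending \<open>1, \<dots>, m\<close> adds a column to the partition, one box after the other from top to bottom.\<close>

lemma yamanouchi_column:
  assumes "yamanouchi w"
  shows "yamanouchi (w @ [1..<m + 1])"
proof (induction m)
  case 0
  then show ?case using assms by simp
next
  case (Suc m)
  have "dominant (mset w)" using assms by (rule yamanouchi_dominant)
  moreover have "count (mset [1..<l + 1]) i = (if 1 \<le> i \<and> i \<le> l then 1 else 0)" for i l
    by (induction l) auto
  then have "count (mset (w @ [1..<m + 1]) + {#m + 1#}) i =
      count (mset w) i + (if 1 \<le> i \<and> i \<le> m + 1 then 1 else 0)" for i
    by (auto simp del: upt_Suc)
  ultimately have "dominant (mset (w @ [1..<m + 1]) + {#m + 1#})"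
    unfolding dominant_def by (auto intro: le_SucI simp del: mset_append mset_upt upt_Suc count_add_mset)
  then have "yamanouchi ((w @ [1..<m + 1]) @ [m + 1])"
    using Suc by (intro yamanouchi.snoc) auto
  then show ?case by simp
qed

lemma yamanouchi_columns: "yamanouchi (concat (map (\<lambda>m. [1..<m + 1]) ms))"
proof (induction ms rule: rev_induct)
  case (snoc m ms)
  from yamanouchi_column[OF this, of m] show ?case by simp
qed (simp add: yamanouchi.Nil)

text \<open>The bound on \<open>p\<close> keeps the moved triple inside the word, so that the step remains the same when
letters are appended.\<close>

definition knuth_step :: "nat list \<Rightarrow> nat list \<Rightarrow> bool" where
  "knuth_step u v \<longleftrightarrow> (\<exists>p. p + 3 \<le> length u \<and> v = knuth_move p u)"

lemma knuth_move_append: "p + 3 \<le> length u \<Longrightarrow> knuth_move p (u @ w) = knuth_move p u @ w"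
  by (induction p u rule: knuth_move.induct) auto

lemma length_knuth_move [simp]: "length (knuth_move p w) = length w"
  using mset_knuth_move by (rule mset_eq_length)

lemma knuth_steps_sym: "knuth_step\<^sup>*\<^sup>* u v \<Longrightarrow> knuth_step\<^sup>*\<^sup>* v u"
  by (rule sympD[OF symp_rtranclp])
   (auto simp: symp_def knuth_step_def knuth_move_involution intro: exI)

lemma knuth_steps_append: "knuth_step\<^sup>*\<^sup>* u v \<Longrightarrow> knuth_step\<^sup>*\<^sup>* (u @ w) (v @ w)"
proof (induction rule: rtranclp_induct)
  case (step v v')
  then have "knuth_step (v @ w) (v' @ w)"
    unfolding knuth_step_def by (metis knuth_move_append le_add1 le_trans length_append)
  with step.IH show ?case by simp
qed simp

lemma knuth_steps_moves: "knuth_step\<^sup>*\<^sup>* u v \<Longrightarrow> \<exists>ps. fold knuth_move ps u = v"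
proof (induction rule: rtranclp_induct)
  case base
  show ?case by (intro exI[of _ "[]"]) simp
next
  case (step v v')
  then obtain ps p where "fold knuth_move ps u = v" "v' = knuth_move p v"
    by (auto simp: knuth_step_def)
  then show ?case by (intro exI[of _ "ps @ [p]"]) simp
qed

lemma knuth_step_last:
  assumes "a \<le> y" "y < b"
  shows "knuth_step (t @ [y, b, a]) (t @ [y, a, b])"
proof -
  have "knuth_move (length t) (t @ [y, b, a]) = t @ [y, a, b]"
    using assms by (induction t) (auto simp: last_between_def first_between_def)
  then show ?thesis unfolding knuth_step_def by (intro exI[of _ "length t"]) simp
qed

text \<open>By induction on the length, two words ending in the same letter are linked through their initial
segments. If the last letters are \<open>a < b\<close>, then rows \<open>a\<close> and \<open>b\<close> of the content both end in a
corner, and after their removal row \<open>b - 1\<close> ends in a corner too, as it has become longer than row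
\<open>b\<close> even if \<open>a = b - 1\<close>. With \<open>t\<close> a Yamanouchi word for what then remains, both
\<open>t, b - 1, b, a\<close> and \<open>t, b - 1, a, b\<close> are Yamanouchi words. They differ by one Knuth move with witness \<open>b - 1\<close>,
and the induction hypothesis links each of them to the given word with the same last letter.\<close>

lemma yamanouchi_connected:
  assumes "yamanouchi u" "yamanouchi v" "mset u = mset v"
  shows "knuth_step\<^sup>*\<^sup>* u v"
  using assms
proof (induction "length u" arbitrary: u v)
  case 0
  then show ?case by simp
next
  case (Suc k)
  have different: "knuth_step\<^sup>*\<^sup>* (u @ [a]) (v @ [b])"
    if "a < b" and u: "yamanouchi (u @ [a])" and v: "yamanouchi (v @ [b])"
      and eq: "mset (u @ [a]) = mset (v @ [b])" and len: "length u = k" for u v a b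
  proof -
    define N where "N = mset u - {#b#} - {#b - 1#}"
    define c where "c = count (mset u)"
    have cv: "count (mset v) i + (if i = b then 1 else 0) = c i + (if i = a then 1 else 0)" for i
      using arg_cong[OF eq, of "\<lambda>M. count M i"] by (auto simp: c_def split: if_splits)
    have a: "1 \<le> a" using u yamanouchi_snocD by blast
    have dom_u: "c (Suc i) \<le> c i" if "1 \<le> i" for i
      using yamanouchi_dominant[of u] yamanouchi_snocD[OF u] that by (auto simp: dominant_def c_def)
    have dom_v: "count (mset v) (Suc i) \<le> count (mset v) i" if "1 \<le> i" for i
      using yamanouchi_dominant[of v] yamanouchi_snocD[OF v] that by (auto simp: dominant_def)
    obtain y where y: "b = Suc y" "a \<le> y" using \<open>a < b\<close> by (cases b) auto
    have "c b > 0" using cv[of b] \<open>a < b\<close> by auto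
    moreover from this have "c y > 0" using dom_u[of y] y a by simp
    ultimately have "b \<in># mset u" "y \<in># mset u"
      unfolding c_def count_greater_zero_iff .
    then have "b \<in># mset u" "y \<in># mset u - {#b#}"
      using y by (auto simp: in_diff_count)
    then have "add_mset b (add_mset y N) = mset u"
      unfolding N_def y(1) diff_Suc_1 by (simp only: insert_DiffM)
    then have u_eq: "mset u = N + {#b#} + {#y#}" by (metis add_mset_add_single add_mset_commute)
    then have c: "c i = count N i + (if i = b then 1 else 0) + (if i = y then 1 else 0)" for i
      by (auto simp: c_def)
    have le: "count N (Suc i) \<le> count N i"
      "count (N + {#y#}) (Suc i) \<le> count (N + {#y#}) i" if "1 \<le> i" for i
      using dom_u[OF that] dom_v[OF that] cv[of i] cv[of "Suc i"] c[of i] c[of "Suc i"] y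
      by (auto split: if_splits)
    have "0 \<notin># mset u" using yamanouchi_positive[of u] yamanouchi_snocD[OF u] by auto
    then have "0 \<notin># N" using u_eq by auto
    moreover have "dominant N" using le(1) by (simp add: dominant_def)
    ultimately obtain t where t: "yamanouchi t" "mset t = N" using yamanouchi_exists by blast
    have ty: "yamanouchi (t @ [y])"
      using t le(2) y a by (intro yamanouchi.snoc) (auto simp: dominant_def)
    have u_mset: "mset u = mset (t @ [y] @ [b])" using u_eq t by simp
    then have v_mset: "mset v = mset (t @ [y] @ [a])" using eq by simp
    have "mset (t @ [y]) + {#b#} = mset u" "mset (t @ [y]) + {#a#} = mset v"
      using u_mset v_mset by simp_all
    then have tyb: "yamanouchi ((t @ [y]) @ [b])" and tya: "yamanouchi ((t @ [y]) @ [a])"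
      using yamanouchi.snoc[OF ty, of b] yamanouchi.snoc[OF ty, of a] y a
        yamanouchi_snocD[OF u] yamanouchi_snocD[OF v] yamanouchi_dominant by metis+
    have "length v = k" using len arg_cong[OF eq, of size] by simp
    then have "knuth_step\<^sup>*\<^sup>* (t @ [y, a]) v"
      using Suc.hyps(1)[of v "t @ [y, a]"] tya v_mset v yamanouchi_snocD knuth_steps_sym by auto
    moreover have "knuth_step\<^sup>*\<^sup>* u (t @ [y, b])"
      using Suc.hyps(1)[of u "t @ [y, b]"] tyb u_mset u yamanouchi_snocD len by auto
    ultimately have "knuth_step\<^sup>*\<^sup>* (u @ [a]) (t @ [y, b, a])"
      "knuth_step\<^sup>*\<^sup>* (t @ [y, a, b]) (v @ [b])"
      using knuth_steps_append by fastforce+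
    moreover have "knuth_step (t @ [y, b, a]) (t @ [y, a, b])"
      using y by (intro knuth_step_last) auto
    ultimately show ?thesis by (meson converse_rtranclp_into_rtranclp rtranclp_trans)
  qed
  obtain u' a where u: "u = u' @ [a]" using Suc.hyps(2) by (cases u rule: rev_cases) auto
  have "length v = Suc k" using Suc by (metis mset_eq_length)
  then obtain v' b where v: "v = v' @ [b]" by (cases v rule: rev_cases) auto
  have len: "length u' = k" "length v' = k" using Suc.hyps(2) \<open>length v = Suc k\<close> u v by auto
  consider "a < b" | "b < a" | "a = b" by linarith
  then show ?case
  proof cases
    case 1
    then show ?thesis using different[of a b u' v'] Suc.prems u v len by auto
  next
    case 2
    then show ?thesis using different[of b a v' u'] Suc.prems u v len knuth_steps_sym by auto
  next
    case 3
    then have "knuth_step\<^sup>*\<^sup>* u' v'"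
      using Suc.hyps(1)[of u' v'] Suc.prems yamanouchi_snocD u v len by auto
    then show ?thesis using knuth_steps_append u v 3 by simp
  qed
qed

lemma mset_concat_rev: "mset (concat (rev xss)) = mset (concat xss)"
  by (induction xss) simp_all

section \<open>Signatures of tableaux\<close>

text \<open>The sign word of an arbitrary list of boxes, so that signatures can be computed by recursion along the
reading.\<close>

definition signs :: "nat \<Rightarrow> tableau \<Rightarrow> box list \<Rightarrow> (box \<times> sign) list" where
  "signs i T bs =
     concat (map (\<lambda>b. if T b = i then [(b, Plus)] else if T b = i + 1 then [(b, Minus)] else []) bs)"

definition minuses :: "nat \<Rightarrow> tableau \<Rightarrow> box list \<Rightarrow> box list" where
  "minuses i T bs = map fst (filter (\<lambda>x. snd x = Minus) (reduced_word (signs i T bs)))"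

definition pluses :: "nat \<Rightarrow> tableau \<Rightarrow> box list \<Rightarrow> box list" where
  "pluses i T bs = map fst (filter (\<lambda>x. snd x = Plus) (reduced_word (signs i T bs)))"

text \<open>In a reduced word the minus signs come first. So a plus put in front cancels the first of them, and
joins the plus signs only if there are none.\<close>

lemma filter_cancel_cons_Plus:
  fixes v :: "(box \<times> sign) list"
  defines "w \<equiv> reduced_word v"
  shows "filter (\<lambda>x. snd x = Minus) (cancel_cons (b, Plus) w) = tl (filter (\<lambda>x. snd x = Minus) w) \<and>
    filter (\<lambda>x. snd x = Plus) (cancel_cons (b, Plus) w) =
      (if filter (\<lambda>x. snd x = Minus) w = [] then [(b, Plus)] else []) @ filter (\<lambda>x. snd x = Plus) w"
proof -
  obtain p q where w: "w = p @ q" and p: "\<forall>x \<in> set p. snd x = Minus" and q: "\<forall>x \<in> set q. snd x = Plus"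
    unfolding w_def using reduced_word_form by blast
  have filters: "filter (\<lambda>x. snd x = Minus) q = []" "filter (\<lambda>x. snd x = Plus) q = q"
    using q by (auto simp: filter_empty_conv filter_id_conv)
  show ?thesis
  proof (cases p)
    case Nil
    then have "cancel_cons (b, Plus) w = (b, Plus) # w"
      using w q by (cases q) auto
    then show ?thesis using w Nil filters by simp
  next
    case (Cons y p')
    then obtain b' where "y = (b', Minus)" using p by (cases y) auto
    then show ?thesis using w Cons by simp
  qed
qed

lemma minuses_pluses_simps:
  "minuses i T [] = []"
  "pluses i T [] = []"
  "minuses i T (b # bs) =
    (if T b = i then tl (minuses i T bs)
     else if T b = Suc i then b # minuses i T bs else minuses i T bs)"
  "pluses i T (b # bs) =
    (if T b = i \<and> minuses i T bs = [] then b # pluses i T bs else pluses i T bs)"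
  using filter_cancel_cons_Plus[of b "signs i T bs"]
  by (simp_all add: minuses_def pluses_def signs_def reduced_word_def map_tl)

lemma length_minuses: "length (minuses i T bs) = nminus i (map T bs)"
  by (induction bs) (auto simp: minuses_pluses_simps)

lemma minuses_eq_Nil_iff: "minuses i T bs = [] \<longleftrightarrow> nminus i (map T bs) = 0"
  by (metis length_0_conv length_minuses)

lemma pluses_eq_Nil_iff: "pluses i T bs = [] \<longleftrightarrow> nplus i (map T bs) = 0"
  by (induction bs) (auto simp: minuses_pluses_simps minuses_eq_Nil_iff)

text \<open>The box on which \<open>f\<^sub>i\<close> acts is the one described by \<open>word_f_eq_Some_iff\<close>; the next lemma says the
same for \<open>e\<^sub>i\<close>.\<close>

lemma hd_pluses:
  assumes "pluses i T bs \<noteq> []"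
  obtains us vs where "bs = us @ hd (pluses i T bs) # vs" "T (hd (pluses i T bs)) = i"
    "nplus i (map T us) = 0" "nminus i (map T vs) = 0"
  using assms
proof (induction bs arbitrary: thesis)
  case Nil
  then show ?case by (simp add: minuses_pluses_simps)
next
  case (Cons b bs)
  show ?case
  proof (cases "T b = i \<and> minuses i T bs = []")
    case True
    then show ?thesis
      using Cons.prems(1)[of "[]" bs] by (simp add: minuses_pluses_simps minuses_eq_Nil_iff)
  next
    case False
    then have same: "pluses i T (b # bs) = pluses i T bs" by (auto simp: minuses_pluses_simps)
    with Cons obtain us vs where bs: "bs = us @ hd (pluses i T bs) # vs"
      "T (hd (pluses i T bs)) = i" "nplus i (map T us) = 0" "nminus i (map T vs) = 0" by metis
    have "map T bs = map T us @ i # map T vs" using bs(1,2) by (metis list.simps(9) map_append)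
    then have "nminus i (map T bs) = nminus i (map T us)" using bs by (simp add: nminus_append)
    then have "nplus i (map T (b # us)) = 0" using False bs by (auto simp: minuses_eq_Nil_iff)
    then show ?thesis using Cons.prems(1)[of "b # us" vs] bs same by auto
  qed
qed

lemma last_minuses:
  assumes "minuses i T bs \<noteq> []"
  obtains us vs where "bs = us @ last (minuses i T bs) # vs" "T (last (minuses i T bs)) = Suc i"
    "nplus i (map T us) = 0" "nminus i (map T vs) = 0"
  using assms
proof (induction bs arbitrary: thesis)
  case Nil
  then show ?case by (simp add: minuses_pluses_simps)
next
  case (Cons b bs)
  show ?case
  proof (cases "T b = Suc i \<and> minuses i T bs = []")
    case True
    then show ?thesis
      using Cons.prems(1)[of "[]" bs] by (simp add: minuses_pluses_simps minuses_eq_Nil_iff)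
  next
    case False
    with Cons.prems(2) have same: "last (minuses i T (b # bs)) = last (minuses i T bs)"
      and ne: "minuses i T bs \<noteq> []"
      by (auto simp: minuses_pluses_simps last_tl tl_Nil split: if_splits)
    have two: "length (minuses i T bs) > 1" if "T b = i"
    proof -
      have "tl (minuses i T bs) \<noteq> []" using Cons.prems(2) that by (simp add: minuses_pluses_simps)
      then show ?thesis by (metis length_greater_0_conv length_tl zero_less_diff)
    qed
    obtain us vs where bs: "bs = us @ last (minuses i T bs) # vs"
      "T (last (minuses i T bs)) = Suc i" "nplus i (map T us) = 0" "nminus i (map T vs) = 0"
      using Cons.IH[OF _ ne] by blast
    have "map T bs = map T us @ Suc i # map T vs" using bs(1,2) by (metis list.simps(9) map_append)
    then have "nminus i (map T bs) = Suc (nminus i (map T us))" using bs by (simp add: nminus_append)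
    then have "nplus i (map T (b # us)) = 0" using two bs by (auto simp: length_minuses)
    then show ?thesis using Cons.prems(1)[of "b # us" vs] bs same by auto
  qed
qed

definition reading :: "(nat \<Rightarrow> real) \<Rightarrow> tableau \<Rightarrow> nat list" where
  "reading lam T = map T (far_eastern lam)"

lemma ftilde_pluses:
  "ftilde lam i T =
    (let ps = pluses i T (far_eastern lam) in if ps = [] then None else Some (T(hd ps := Suc i)))"
  by (auto simp: ftilde_def pluses_def signature_def sign_word_def signs_def Let_def hd_map)

lemma etilde_minuses:
  "etilde lam i T =
    (let ms = minuses i T (far_eastern lam) in if ms = [] then None else Some (T(last ms := i)))"
  by (auto simp: etilde_def minuses_def signature_def sign_word_def signs_def Let_def last_map)

lemma ftilde_eq_None_iff: "ftilde lam i T = None \<longleftrightarrow> word_f i (reading lam T) = None"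
  by (simp add: ftilde_pluses Let_def pluses_eq_Nil_iff word_f_eq_None_iff reading_def)

lemma etilde_eq_None_iff: "etilde lam i T = None \<longleftrightarrow> nminus i (reading lam T) = 0"
  by (simp add: etilde_minuses Let_def minuses_eq_Nil_iff reading_def)

lemma ftilde_SomeE:
  assumes "ftilde lam i T = Some T'"
  obtains us b vs where "far_eastern lam = us @ b # vs" "T b = i" "T' = T(b := Suc i)"
    "nplus i (map T us) = 0" "nminus i (map T vs) = 0"
proof -
  from assms have ne: "pluses i T (far_eastern lam) \<noteq> []"
    and "T' = T(hd (pluses i T (far_eastern lam)) := Suc i)"
    by (auto simp: ftilde_pluses Let_def split: if_splits)
  with hd_pluses[OF ne] that show thesis by metis
qed

lemma etilde_SomeE:
  assumes "etilde lam i T = Some T'"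
  obtains us b vs where "far_eastern lam = us @ b # vs" "T b = Suc i" "T' = T(b := i)"
    "nplus i (map T us) = 0" "nminus i (map T vs) = 0"
proof -
  from assms have ne: "minuses i T (far_eastern lam) \<noteq> []"
    and "T' = T(last (minuses i T (far_eastern lam)) := i)"
    by (auto simp: etilde_minuses Let_def split: if_splits)
  with last_minuses[OF ne] that show thesis by metis
qed

text \<open>The order in which the Far-Eastern reading visits the boxes.\<close>

definition before :: "box \<Rightarrow> box \<Rightarrow> bool" where
  "before = (\<lambda>(r, c) (r', c'). c' < c \<or> c = c' \<and> r < r')"

lemma sorted_far_eastern: "sorted_wrt before (far_eastern lam)"
proof -
  have "sorted_wrt before (concat (map (\<lambda>c. map (\<lambda>r. (r, c)) [1..<f c + 1]) cs))"
    if "sorted_wrt (\<lambda>c c'. c > c') cs" for cs :: "nat list" and f :: "nat \<Rightarrow> nat"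
    using that
    by (induction cs) (auto simp: sorted_wrt_append sorted_wrt_map before_def simp del: upt_Suc)
  moreover have "sorted_wrt (\<lambda>c c'. c > c') (rev [1..<m + 1])" for m :: nat
    unfolding sorted_wrt_rev using sorted_wrt_upt by blast
  ultimately show ?thesis unfolding far_eastern_def by blast
qed

lemma distinct_far_eastern: "distinct (far_eastern lam)"
proof -
  have "sorted_wrt before bs \<Longrightarrow> distinct bs" for bs
    by (induction bs) (auto simp: before_def)
  then show ?thesis using sorted_far_eastern by blast
qed

lemma reading_ftilde:
  assumes "ftilde lam i T = Some T'"
  shows "word_f i (reading lam T) = Some (reading lam T')"
proof -
  obtain us b vs where bs: "far_eastern lam = us @ b # vs" "T b = i" "T' = T(b := Suc i)"
    "nplus i (map T us) = 0" "nminus i (map T vs) = 0"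
    using assms by (rule ftilde_SomeE)
  have "b \<notin> set us" "b \<notin> set vs" using distinct_far_eastern[of lam] bs(1) by auto
  then have "map T' us = map T us" "map T' vs = map T vs" using bs(3) by auto
  then have "reading lam T = map T us @ i # map T vs"
    "reading lam T' = map T us @ Suc i # map T vs"
    using bs by (simp_all add: reading_def)
  with bs(4,5) show ?thesis unfolding word_f_eq_Some_iff by blast
qed

lemma reading_etilde:
  assumes "etilde lam i T = Some T'"
  shows "word_f i (reading lam T') = Some (reading lam T)"
proof -
  obtain us b vs where bs: "far_eastern lam = us @ b # vs" "T b = Suc i" "T' = T(b := i)"
    "nplus i (map T us) = 0" "nminus i (map T vs) = 0"
    using assms by (rule etilde_SomeE)
  have "b \<notin> set us" "b \<notin> set vs" using distinct_far_eastern[of lam] bs(1) by auto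
  then have "map T' us = map T us" "map T' vs = map T vs" using bs(3) by auto
  then have "reading lam T = map T us @ Suc i # map T vs"
    "reading lam T' = map T us @ i # map T vs"
    using bs by (simp_all add: reading_def)
  with bs(4,5) show ?thesis unfolding word_f_eq_Some_iff by blast
qed

text \<open>Here and in the next lemma, a step on words lifts to the filling whose reading is given, because the
operators on fillings are 0 only where the ones on words are.\<close>

lemma word_f_readingE:
  assumes "word_f i (reading lam T) = Some w"
  obtains T' where "ftilde lam i T = Some T'" "reading lam T' = w"
proof -
  obtain T' where "ftilde lam i T = Some T'" using assms ftilde_eq_None_iff[of lam i T] by auto
  with reading_ftilde[OF this] assms that show thesis by simp
qed

lemma word_f_into_readingE:
  assumes "word_f i w = Some (reading lam T)"
  obtains T' where "etilde lam i T = Some T'" "reading lam T' = w"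
proof -
  have "nminus i (reading lam T) > 0" using assms by (rule nminus_pos_of_word_f)
  then obtain T' where "etilde lam i T = Some T'" using etilde_eq_None_iff[of lam i T] by auto
  with word_f_inj[OF reading_etilde[OF this] assms] that show thesis by blast
qed

section \<open>Semistandard tableaux\<close>

lemma downset_eq_atLeastAtMost_card:
  fixes S :: "nat set"
  assumes "finite S" "0 \<notin> S" "\<And>r r'. r \<in> S \<Longrightarrow> 1 \<le> r' \<Longrightarrow> r' \<le> r \<Longrightarrow> r' \<in> S"
  shows "S = {1..card S}"
proof (cases "S = {}")
  case False
  have "S = {1..Max S}"
  proof
    show "S \<subseteq> {1..Max S}" using assms(1,2) by (auto simp: Suc_le_eq intro: gr0I)
    show "{1..Max S} \<subseteq> S" using assms(3)[OF Max_in[OF assms(1) False]] by auto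
  qed
  moreover from this have "card S = Max S" by (metis card_atLeastAtMost diff_Suc_1)
  ultimately show ?thesis by simp
qed simp

locale dominant_weight =
  fixes n :: nat and lam :: "nat \<Rightarrow> real"
  assumes lam: "lam \<in> Pplus n"
begin

lemma row_lengths:
  obtains L :: "nat \<Rightarrow> nat" where "diagram lam = {(r, c). 1 \<le> r \<and> 1 \<le> c \<and> c \<le> L r}"
    "\<And>r r'. r \<le> r' \<Longrightarrow> L r' \<le> L r" "\<And>r. n < r \<Longrightarrow> L r = 0"
proof -
  obtain a :: "nat \<Rightarrow> nat" where a: "lam = (\<lambda>x. \<Sum>i = 1..n. real (a i) * omega i x)"
    using lam by (auto simp: Pplus_def)
  define L where "L r = (\<Sum>j = r..n. a j)" for r
  have "lam r = real (L r)" if "1 \<le> r" for r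
    unfolding a L_def using weight_coordinate[OF that] .
  then have "diagram lam = {(r, c). 1 \<le> r \<and> 1 \<le> c \<and> c \<le> L r}" by (auto simp: diagram_def)
  moreover have "L r' \<le> L r" if "r \<le> r'" for r r'
    unfolding L_def using that by (intro sum_mono2) auto
  moreover have "L r = 0" if "n < r" for r unfolding L_def using that by simp
  ultimately show thesis by (rule that)
qed

lemma diagram_le_n:
  assumes "(r, c) \<in> diagram lam"
  shows "r \<le> n"
proof (rule ccontr)
  assume "\<not> r \<le> n"
  obtain L where L: "diagram lam = {(r, c). 1 \<le> r \<and> 1 \<le> c \<and> c \<le> L r}" "\<And>r. n < r \<Longrightarrow> L r = 0"
    by (rule row_lengths) blast
  have "L r = 0" using L(2) \<open>\<not> r \<le> n\<close> by simp
  then show False using assms unfolding L(1) by auto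
qed

lemma diagram_downward:
  assumes "(r, c) \<in> diagram lam" "1 \<le> r'" "r' \<le> r" "1 \<le> c'" "c' \<le> c"
  shows "(r', c') \<in> diagram lam"
proof -
  obtain L where L: "diagram lam = {(r, c). 1 \<le> r \<and> 1 \<le> c \<and> c \<le> L r}"
    "\<And>r r'. r \<le> r' \<Longrightarrow> L r' \<le> L r" by (rule row_lengths) blast
  have "L r \<le> L r'" using L(2) assms(3) .
  then show ?thesis using assms unfolding L(1) by auto
qed

lemma diagram_pos: "(r, c) \<in> diagram lam \<Longrightarrow> 1 \<le> r \<and> 1 \<le> c"
  by (auto simp: diagram_def)

lemma diagram_col: "(r, c) \<in> diagram lam \<longleftrightarrow> 1 \<le> c \<and> 1 \<le> r \<and> r \<le> col_len lam c"
proof (cases "1 \<le> c")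
  case True
  have "{r. (r, c) \<in> diagram lam} = {1..col_len lam c}"
    unfolding col_len_def
  proof (rule downset_eq_atLeastAtMost_card)
    show "finite {r. (r, c) \<in> diagram lam}"
      by (rule finite_subset[of _ "{..n}"]) (use diagram_le_n in blast, simp)
    show "0 \<notin> {r. (r, c) \<in> diagram lam}" using diagram_pos[of 0 c] by auto
    show "r' \<in> {r. (r, c) \<in> diagram lam}" if "r \<in> {r. (r, c) \<in> diagram lam}" "1 \<le> r'" "r' \<le> r" for r r'
      using diagram_downward[of r c r' c] that True by auto
  qed
  then show ?thesis using True unfolding set_eq_iff mem_Collect_eq atLeastAtMost_iff by blast
next
  case False
  then show ?thesis using diagram_pos[of r c] by blast
qed

lemma col_len_le: "1 \<le> c \<Longrightarrow> col_len lam c \<le> n"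
  using diagram_col[of "col_len lam c" c] diagram_le_n[of "col_len lam c" c]
  by (cases "col_len lam c = 0") simp_all

lemma diagram_row1: "(1, c) \<in> diagram lam \<longleftrightarrow> 1 \<le> c \<and> c \<le> row_len lam 1"
proof -
  obtain L where L: "diagram lam = {(r, c). 1 \<le> r \<and> 1 \<le> c \<and> c \<le> L r}"
    by (rule row_lengths) blast
  have "{c. (1, c) \<in> diagram lam} = {1..L 1}" unfolding L by auto
  moreover from this have "row_len lam 1 = L 1" by (simp add: row_len_def)
  ultimately show ?thesis unfolding set_eq_iff mem_Collect_eq atLeastAtMost_iff by simp
qed

lemma set_far_eastern: "set (far_eastern lam) = diagram lam"
proof -
  have "(r, c) \<in> set (far_eastern lam) \<longleftrightarrow> (1, c) \<in> diagram lam \<and> (r, c) \<in> diagram lam" for r c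
    unfolding diagram_row1 diagram_col[of r] far_eastern_def
    by (auto simp del: upt_Suc simp: image_iff less_Suc_eq_le)
  moreover have "(1, c) \<in> diagram lam" if "(r, c) \<in> diagram lam" for r c
    using diagram_downward[OF that, of 1 c] diagram_pos[OF that] by auto
  ultimately show ?thesis by auto
qed

lemma tableauD:
  assumes "T \<in> tableaux n lam"
  shows "(r, c) \<in> diagram lam \<Longrightarrow> T (r, c) \<in> {1..n + 1}"
    and "(r, c) \<notin> diagram lam \<Longrightarrow> T (r, c) = 0"
    and "(r, c) \<in> diagram lam \<Longrightarrow> (r, c') \<in> diagram lam \<Longrightarrow> c \<le> c' \<Longrightarrow> T (r, c) \<le> T (r, c')"
    and "(r, c) \<in> diagram lam \<Longrightarrow> (r', c) \<in> diagram lam \<Longrightarrow> r < r' \<Longrightarrow> T (r, c) < T (r', c)"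
  using assms unfolding tableaux_def by (blast, blast, cases "c = c'", simp, force, blast)

lemma split_far_eastern:
  assumes "far_eastern lam = us @ b # vs"
  shows "\<And>x. x \<in> set us \<Longrightarrow> x \<in> diagram lam \<and> before x b"
    and "\<And>x. x \<in> set vs \<Longrightarrow> x \<in> diagram lam \<and> before b x"
    and "\<And>x. x \<in> diagram lam \<Longrightarrow> before x b \<Longrightarrow> x \<in> set us"
    and "\<And>x. x \<in> diagram lam \<Longrightarrow> before b x \<Longrightarrow> x \<in> set vs"
    and "b \<in> diagram lam"
proof -
  have order: "before x b" if "x \<in> set us" for x
    using sorted_far_eastern[of lam] that by (auto simp: assms sorted_wrt_append)
  have order': "before b x" if "x \<in> set vs" for x
    using sorted_far_eastern[of lam] that by (auto simp: assms sorted_wrt_append)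
  have asym: "before x y \<Longrightarrow> \<not> before y x" for x y
    by (cases x; cases y) (auto simp: before_def)
  have set: "diagram lam = set us \<union> {b} \<union> set vs"
    using set_far_eastern by (auto simp: assms)
  show "x \<in> set us \<Longrightarrow> x \<in> diagram lam \<and> before x b" for x using set order by auto
  show "x \<in> set vs \<Longrightarrow> x \<in> diagram lam \<and> before b x" for x using set order' by auto
  show "x \<in> diagram lam \<Longrightarrow> before x b \<Longrightarrow> x \<in> set us" for x using set order' asym by blast
  show "x \<in> diagram lam \<Longrightarrow> before b x \<Longrightarrow> x \<in> set vs" for x using set order asym by blast
  show "b \<in> diagram lam" using set by blast
qed

text \<open>Let the operator act on box \<open>b = (r, c)\<close>. Its plus survives and is the leftmost one. Raising the entry
could only violate the conditions against an entry \<open>i + 1\<close> below or an entry \<open>i\<close> to the right.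
The first would be read right after \<open>b\<close> and cancel its plus. The nearest entry of the second kind
would be read before \<open>b\<close> with no sign in between, so its plus would survive as well, further to the
left in the signature.\<close>

lemma ftilde_tableau:
  assumes T: "T \<in> tableaux n lam" and i: "i \<in> {1..n}" and f: "ftilde lam i T = Some T'"
  shows "T' \<in> tableaux n lam"
proof -
  obtain us b vs where bs: "far_eastern lam = us @ b # vs" "T b = i" "T' = T(b := Suc i)"
    "nplus i (map T us) = 0" "nminus i (map T vs) = 0"
    using f by (rule ftilde_SomeE)
  obtain r c where b: "b = (r, c)" by (cases b)
  note D = split_far_eastern[OF bs(1)[unfolded b]]
  have below: "Suc i < T (r', c)" if r': "(r', c) \<in> diagram lam" "r < r'" for r'
  proof -
    have "T (r', c) \<noteq> Suc i"
    proof
      assume Tr': "T (r', c) = Suc i"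
      have "(r', c) \<in> set vs" using D(4) r' by (simp add: before_def)
      then obtain ws zs where vs: "vs = ws @ (r', c) # zs" by (auto dest: split_list)
      have "T x \<noteq> i \<and> T x \<noteq> Suc i" if "x \<in> set ws" for x
      proof -
        obtain p q where x: "x = (p, q)" by (cases x)
        have far: "far_eastern lam = (us @ (r, c) # ws) @ (r', c) # zs" using bs(1) b vs by simp
        have "before (r, c) x" "before x (r', c)" "x \<in> diagram lam"
          using split_far_eastern(1)[OF far, of x] D(2)[of x] that vs by auto
        then have "q = c" "r < p" "p < r'" "(p, c) \<in> diagram lam" by (auto simp: before_def x)
        then have "T (r, c) < T (p, c)" "T (p, c) < T (r', c)"
          using tableauD(4)[OF T] D(5) r' by auto
        then show ?thesis using bs(2) b Tr' x \<open>q = c\<close> by auto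
      qed
      then have "nminus i (map T ws @ Suc i # map T zs) > 0" by (rule nminus_skip)
      with bs(5) vs Tr' show False by simp
    qed
    moreover have "T (r, c) < T (r', c)" using tableauD(4)[OF T] D(5) r' by auto
    ultimately show ?thesis using bs(2) b by auto
  qed
  have right: "Suc i \<le> T (r, c')" if c': "(r, c') \<in> diagram lam" "c < c'" for c'
  proof (rule ccontr)
    assume "\<not> Suc i \<le> T (r, c')"
    have next_col: "(r, Suc c) \<in> diagram lam"
      using c' diagram_downward[of r c' r "Suc c"] diagram_pos[of r c'] by auto
    have "T (r, c) \<le> T (r, Suc c)" "T (r, Suc c) \<le> T (r, c')"
      using tableauD(3)[OF T] next_col c' D(5) by auto
    with \<open>\<not> Suc i \<le> T (r, c')\<close> have T_next: "T (r, Suc c) = i" using bs(2) b by auto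
    have "(r, Suc c) \<in> set us" using D(3) next_col by (simp add: before_def)
    then obtain ws zs where us: "us = ws @ (r, Suc c) # zs" by (auto dest: split_list)
    have "T x \<noteq> i \<and> T x \<noteq> Suc i" if "x \<in> set zs" for x
    proof -
      obtain p q where x: "x = (p, q)" by (cases x)
      have far: "far_eastern lam = ws @ (r, Suc c) # (zs @ b # vs)" using bs(1) us by simp
      have "before (r, Suc c) x" "before x (r, c)" and xD: "x \<in> diagram lam"
        using split_far_eastern(2)[OF far, of x] D(1)[of x] that us by auto
      then consider "q = Suc c" "r < p" | "q = c" "p < r" by (auto simp: before_def x)
      then show ?thesis
      proof cases
        case 1
        have "(p, c) \<in> diagram lam"
          using diagram_downward[of p q p c] xD x 1 diagram_pos[OF xD[unfolded x]] diagram_pos[OF D(5)] by auto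
        then have "Suc i < T (p, c)" "T (p, c) \<le> T (p, q)"
          using below 1 tableauD(3)[OF T] xD x by auto
        then show ?thesis using x by auto
      next
        case 2
        then have "T (p, c) < T (r, c)" using tableauD(4)[OF T] D(5) xD x by auto
        then show ?thesis using x 2 bs(2) b by auto
      qed
    qed
    then have "nplus i (map T ws @ i # map T zs) > 0" by (rule nplus_skip)
    with bs(4) us T_next show False by simp
  qed
  show ?thesis
    unfolding tableaux_def
  proof (intro CollectI conjI allI ballI impI)
    fix x assume "x \<in> diagram lam"
    then show "T' x \<in> {1..n + 1}" using tableauD(1)[OF T, of "fst x" "snd x"] i bs(3) by auto
  next
    fix x assume "x \<notin> diagram lam"
    then show "T' x = 0" using tableauD(2)[OF T, of "fst x" "snd x"] D(5) b bs(3) by auto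
  next
    fix r0 c0 c1 assume *: "(r0, c0) \<in> diagram lam \<and> (r0, c1) \<in> diagram lam \<and> c0 < c1"
    then have "T (r0, c0) \<le> T (r0, c1)" using tableauD(3)[OF T] by auto
    then show "T' (r0, c0) \<le> T' (r0, c1)" using right[of c1] * bs(2,3) b by auto
  next
    fix r0 r1 c0 assume *: "(r0, c0) \<in> diagram lam \<and> (r1, c0) \<in> diagram lam \<and> r0 < r1"
    then have "T (r0, c0) < T (r1, c0)" using tableauD(4)[OF T] by auto
    then show "T' (r0, c0) < T' (r1, c0)" using below[of r1] * bs(2,3) b by auto
  qed
qed

text \<open>
The mirror image of the previous argument: an entry \<open>i\<close> above \<open>b\<close> would cancel its minus, and the
minus of the nearest entry \<open>i + 1\<close> to the left of \<open>b\<close> would survive further to the right in the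
signature.\<close>

lemma etilde_tableau:
  assumes T: "T \<in> tableaux n lam" and i: "i \<in> {1..n}" and e: "etilde lam i T = Some T'"
  shows "T' \<in> tableaux n lam"
proof -
  obtain us b vs where bs: "far_eastern lam = us @ b # vs" "T b = Suc i" "T' = T(b := i)"
    "nplus i (map T us) = 0" "nminus i (map T vs) = 0"
    using e by (rule etilde_SomeE)
  obtain r c where b: "b = (r, c)" by (cases b)
  note D = split_far_eastern[OF bs(1)[unfolded b]]
  have above: "T (r', c) < i" if r': "(r', c) \<in> diagram lam" "r' < r" for r'
  proof -
    have "T (r', c) \<noteq> i"
    proof
      assume Tr': "T (r', c) = i"
      have "(r', c) \<in> set us" using D(3) r' by (simp add: before_def)
      then obtain ws zs where us: "us = ws @ (r', c) # zs" by (auto dest: split_list)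
      have "T x \<noteq> i \<and> T x \<noteq> Suc i" if "x \<in> set zs" for x
      proof -
        obtain p q where x: "x = (p, q)" by (cases x)
        have far: "far_eastern lam = ws @ (r', c) # (zs @ b # vs)" using bs(1) us by simp
        have "before (r', c) x" "before x (r, c)" "x \<in> diagram lam"
          using split_far_eastern(2)[OF far, of x] D(1)[of x] that us by auto
        then have "q = c" "r' < p" "p < r" "(p, c) \<in> diagram lam" by (auto simp: before_def x)
        then have "T (r', c) < T (p, c)" "T (p, c) < T (r, c)"
          using tableauD(4)[OF T] D(5) r' by auto
        then show ?thesis using bs(2) b Tr' x \<open>q = c\<close> by auto
      qed
      then have "nplus i (map T ws @ i # map T zs) > 0" by (rule nplus_skip)
      with bs(4) us Tr' show False by simp
    qed
    moreover have "T (r', c) < T (r, c)" using tableauD(4)[OF T] D(5) r' by auto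
    ultimately show ?thesis using bs(2) b by auto
  qed
  have left: "T (r, c') \<le> i" if c': "(r, c') \<in> diagram lam" "c' < c" for c'
  proof (rule ccontr)
    assume "\<not> T (r, c') \<le> i"
    obtain d where c: "c = Suc d" using c' by (cases c) auto
    have prev_col: "(r, d) \<in> diagram lam"
      using c c' diagram_downward[OF D(5), of r d] diagram_pos[of r c'] by auto
    have "T (r, c') \<le> T (r, d)" "T (r, d) \<le> T (r, c)"
      using tableauD(3)[OF T] prev_col c c' D(5) by auto
    with \<open>\<not> T (r, c') \<le> i\<close> have T_prev: "T (r, d) = Suc i" using bs(2) b by auto
    have "(r, d) \<in> set vs" using D(4) prev_col c by (simp add: before_def)
    then obtain ws zs where vs: "vs = ws @ (r, d) # zs" by (auto dest: split_list)
    have "T x \<noteq> i \<and> T x \<noteq> Suc i" if "x \<in> set ws" for x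
    proof -
      obtain p q where x: "x = (p, q)" by (cases x)
      have far: "far_eastern lam = (us @ b # ws) @ (r, d) # zs" using bs(1) vs by simp
      have "before x (r, d)" "before (r, c) x" and xD: "x \<in> diagram lam"
        using split_far_eastern(1)[OF far, of x] D(2)[of x] that vs by auto
      then consider "q = d" "p < r" | "q = c" "r < p" by (auto simp: before_def x c)
      then show ?thesis
      proof cases
        case 1
        have "(p, c) \<in> diagram lam"
          using diagram_downward[OF D(5), of p c] 1 x diagram_pos[OF xD[unfolded x]] diagram_pos[OF D(5)] by auto
        then have "T (p, c) < i" "T (p, q) \<le> T (p, c)"
          using above 1 tableauD(3)[OF T] xD x c by auto
        then show ?thesis using x by auto
      next
        case 2
        then have "T (r, c) < T (p, c)" using tableauD(4)[OF T] D(5) xD x by auto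
        then show ?thesis using x 2 bs(2) b by auto
      qed
    qed
    then have "nminus i (map T ws @ Suc i # map T zs) > 0" by (rule nminus_skip)
    with bs(5) vs T_prev show False by simp
  qed
  show ?thesis
    unfolding tableaux_def
  proof (intro CollectI conjI allI ballI impI)
    fix x assume "x \<in> diagram lam"
    then show "T' x \<in> {1..n + 1}" using tableauD(1)[OF T, of "fst x" "snd x"] i bs(3) by auto
  next
    fix x assume "x \<notin> diagram lam"
    then show "T' x = 0" using tableauD(2)[OF T, of "fst x" "snd x"] D(5) b bs(3) by auto
  next
    fix r0 c0 c1 assume *: "(r0, c0) \<in> diagram lam \<and> (r0, c1) \<in> diagram lam \<and> c0 < c1"
    then have "T (r0, c0) \<le> T (r0, c1)" using tableauD(3)[OF T] by auto
    then show "T' (r0, c0) \<le> T' (r0, c1)" using left[of c0] * bs(2,3) b by auto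
  next
    fix r0 r1 c0 assume *: "(r0, c0) \<in> diagram lam \<and> (r1, c0) \<in> diagram lam \<and> r0 < r1"
    then have "T (r0, c0) < T (r1, c0)" using tableauD(4)[OF T] by auto
    then show "T' (r0, c0) < T' (r1, c0)" using above[of r0] * bs(2,3) b by auto
  qed
qed

lemma set_reading: "T \<in> tableaux n lam \<Longrightarrow> set (reading lam T) \<subseteq> {1..n + 1}"
  using tableauD(1) set_far_eastern by (fastforce simp: reading_def)

lemma reading_inj:
  assumes "T \<in> tableaux n lam" "T' \<in> tableaux n lam" "reading lam T = reading lam T'"
  shows "T = T'"
proof
  fix x
  show "T x = T' x"
  proof (cases "x \<in> diagram lam")
    case True
    have "\<forall>x \<in> set (far_eastern lam). T x = T' x" using assms(3) by (simp add: reading_def)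
    then show ?thesis using True set_far_eastern by blast
  next
    case False
    then show ?thesis
      using tableauD(2)[OF assms(1), of "fst x" "snd x"] tableauD(2)[OF assms(2), of "fst x" "snd x"]
      by simp
  qed
qed

lemma T_high_tableau: "T_high lam \<in> tableaux n lam"
  using diagram_pos diagram_le_n by (fastforce simp: tableaux_def T_high_def)

lemma T_low_tableau: "T_low n lam \<in> tableaux n lam"
proof -
  have antitone: "col_len lam c' \<le> col_len lam c" if "c \<le> c'" "1 \<le> c" for c c'
  proof (cases "col_len lam c' = 0")
    case False
    then have "(col_len lam c', c') \<in> diagram lam" using diagram_col that by simp
    then have "(col_len lam c', c) \<in> diagram lam"
      using diagram_downward[of "col_len lam c'" c' "col_len lam c'" c] that False by simp
    then show ?thesis using diagram_col by simp
  qed simp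
  show ?thesis
    unfolding tableaux_def
  proof (intro CollectI conjI allI ballI impI)
    fix x assume "x \<in> diagram lam"
    then obtain r c where x: "x = (r, c)" "(r, c) \<in> diagram lam" by (cases x) auto
    then show "T_low n lam x \<in> {1..n + 1}"
      using col_len_le[of c] diagram_pos[of r c] by (auto simp: T_low_def)
  next
    fix x assume "x \<notin> diagram lam"
    then show "T_low n lam x = 0" by (auto simp: T_low_def split: prod.splits)
  next
    fix r c c' assume *: "(r, c) \<in> diagram lam \<and> (r, c') \<in> diagram lam \<and> c < c'"
    then have "col_len lam c' \<le> col_len lam c" using antitone[of c c'] diagram_pos[of r c] by simp
    then show "T_low n lam (r, c) \<le> T_low n lam (r, c')" using * by (simp add: T_low_def)
  next
    fix r r' c assume *: "(r, c) \<in> diagram lam \<and> (r', c) \<in> diagram lam \<and> r < r'"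
    then show "T_low n lam (r, c) < T_low n lam (r', c)"
      using diagram_col[of r c] diagram_col[of r' c] col_len_le[of c] by (auto simp: T_low_def)
  qed
qed

lemma row_le_entry:
  assumes T: "T \<in> tableaux n lam"
  shows "(r, c) \<in> diagram lam \<Longrightarrow> r \<le> T (r, c)"
proof (induction r)
  case (Suc r)
  show ?case
  proof (cases "r = 0")
    case True
    then show ?thesis using tableauD(1)[OF T Suc.prems] by simp
  next
    case False
    then have "(r, c) \<in> diagram lam"
      using diagram_downward[OF Suc.prems, of r c] diagram_pos[OF Suc.prems] by simp
    then show ?thesis using Suc tableauD(4)[OF T, of r c "Suc r"] by simp
  qed
qed simp

text \<open>Follow the reading up to the first box whose entry differs from its row number \<open>r\<close>. The entry is some
\<open>i + 1 > r\<close>, and its minus must be cancelled by an earlier entry \<open>i\<close>, which sits in row \<open>i \<ge> r\<close> of a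
column further right. That column also has a box in row \<open>r\<close>, with the correct entry \<open>r\<close>, and
this contradicts the weak increase along row \<open>r\<close>.\<close>

lemma highest_weight_tableau_unique:
  assumes T: "T \<in> tableaux n lam" and high: "\<And>i. i \<in> {1..n} \<Longrightarrow> nminus i (reading lam T) = 0"
  shows "T = T_high lam"
proof -
  have entry: "T b = fst b" if "far_eastern lam = us @ b # vs" for us b vs
    using that
  proof (induction "length us" arbitrary: us b vs rule: less_induct)
    case less
    note D = split_far_eastern[OF less.prems]
    have earlier: "T x = fst x" if x: "x \<in> set us" for x
    proof -
      obtain ws zs where "us = ws @ x # zs" using x by (auto dest: split_list)
      then show ?thesis using less.hyps[of ws x "zs @ b # vs"] less.prems by simp
    qed
    obtain r c where b: "b = (r, c)" by (cases b)
    have rc: "(r, c) \<in> diagram lam" using D(5) b by simp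
    have "\<not> r < T (r, c)"
    proof
      assume "r < T (r, c)"
      then obtain i where i: "T (r, c) = Suc i" "r \<le> i" by (cases "T (r, c)") auto
      then have "i \<in> {1..n}" using tableauD(1)[OF T rc] diagram_pos[OF rc] by simp
      moreover have "reading lam T = map T us @ Suc i # map T vs"
        using less.prems i b by (simp add: reading_def)
      ultimately have "i \<in> set (map T us)" using high predecessor_precedes by metis
      then obtain x where x: "x \<in> set us" "T x = i" by auto
      then have "fst x = i" using earlier by simp
      then obtain q where q: "x = (i, q)" by (cases x) auto
      have "(i, q) \<in> diagram lam" "c < q" using D(1)[OF x(1)] q b i by (auto simp: before_def)
      then have rq: "(r, q) \<in> diagram lam"
        using diagram_downward[of i q r q] i diagram_pos[OF rc] by simp
      then have "(r, q) \<in> set us" using D(3) b \<open>c < q\<close> by (simp add: before_def)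
      then have "T (r, q) = r" using earlier by force
      moreover have "T (r, c) \<le> T (r, q)" using tableauD(3)[OF T rc rq] \<open>c < q\<close> by simp
      ultimately show False using i by simp
    qed
    then show ?case using row_le_entry[OF T rc] b by simp
  qed
  show ?thesis
  proof
    fix x
    show "T x = T_high lam x"
    proof (cases "x \<in> diagram lam")
      case True
      then obtain us vs where "far_eastern lam = us @ x # vs"
        using set_far_eastern by (metis split_list)
      then show ?thesis using entry True by (auto simp: T_high_def split: prod.splits)
    next
      case False
      then show ?thesis
        using tableauD(2)[OF T, of "fst x" "snd x"] by (auto simp: T_high_def split: prod.splits)
    qed
  qed
qed

text \<open>The crystal is connected: unless \<open>T\<close> is the highest tableau, some \<open>e\<^sub>i\<close> applies to it and lowers
the sum of the entries, and \<open>f\<^sub>i\<close> undoes this step.\<close>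

lemma tableau_induct [consumes 1, case_names high ftilde]:
  assumes "T \<in> tableaux n lam"
    and "P (T_high lam)"
    and step: "\<And>T i T'. T \<in> tableaux n lam \<Longrightarrow> P T \<Longrightarrow> i \<in> {1..n} \<Longrightarrow>
      ftilde lam i T = Some T' \<Longrightarrow> P T'"
  shows "P T"
  using assms(1)
proof (induction "sum_list (reading lam T)" arbitrary: T rule: less_induct)
  case less
  show ?case
  proof (cases "T = T_high lam")
    case True
    then show ?thesis using assms(2) by simp
  next
    case False
    then obtain i where i: "i \<in> {1..n}" "nminus i (reading lam T) \<noteq> 0"
      using highest_weight_tableau_unique less.prems by blast
    then obtain S where S: "etilde lam i T = Some S" using etilde_eq_None_iff[of lam i T] by auto
    have S_tab: "S \<in> tableaux n lam" using etilde_tableau[OF less.prems i(1) S] .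
    have f: "word_f i (reading lam S) = Some (reading lam T)" using S by (rule reading_etilde)
    then have "P S" using less.hyps[of S] S_tab sum_list_word_f[OF f] by simp
    obtain T' where T': "ftilde lam i S = Some T'" "reading lam T' = reading lam T"
      using f by (rule word_f_readingE)
    have "T' = T" using reading_inj[OF ftilde_tableau[OF S_tab i(1) T'(1)] less.prems T'(2)] .
    then show ?thesis using step[OF S_tab \<open>P S\<close> i(1)] T'(1) by simp
  qed
qed

section \<open>Readings of the extremal tableaux\<close>

text \<open>The two readings list the same columns \<open>1, \<dots>, c\<^sub>k\<close>, the first from right to left, the dual of the
second from left to right.\<close>

lemma reading_T_high:
  "reading lam (T_high lam) =
     concat (map (\<lambda>m. [1..<m + 1]) (map (col_len lam) (rev [1..<row_len lam 1 + 1])))"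
proof -
  have "map (\<lambda>r. T_high lam (r, c)) [1..<col_len lam c + 1] = [1..<col_len lam c + 1]"
    if "1 \<le> c" for c
    using that diagram_col by (intro map_idI) (auto simp: T_high_def simp del: upt_Suc)
  then show ?thesis
    unfolding reading_def far_eastern_def map_concat map_map comp_def
    by (intro arg_cong[where f = concat] map_cong refl) (auto simp del: upt_Suc)
qed

lemma dual_reading_T_low:
  "dual n (reading lam (T_low n lam)) =
     concat (map (\<lambda>m. [1..<m + 1]) (map (col_len lam) [1..<row_len lam 1 + 1]))"
proof -
  have "dual n (map (\<lambda>r. T_low n lam (r, c)) [1..<col_len lam c + 1]) = [1..<col_len lam c + 1]"
    if c: "1 \<le> c" for c
  proof -
    have "n + 2 - T_low n lam (r, c) = col_len lam c + 1 - r"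
      if "r \<in> set [1..<col_len lam c + 1]" for r
      using that c diagram_col[of r c] col_len_le[OF c] by (auto simp: T_low_def simp del: upt_Suc)
    then have "map (\<lambda>r. n + 2 - T_low n lam (r, c)) [1..<col_len lam c + 1] =
        map (\<lambda>r. col_len lam c + 1 - r) [1..<col_len lam c + 1]"
      by (intro map_cong refl)
    moreover have "rev (map (\<lambda>r. m + 1 - r) [1..<m + 1]) = [1..<m + 1]" for m :: nat
      by (rule nth_equalityI) (auto simp: rev_nth simp del: upt_Suc)
    ultimately show ?thesis unfolding dual_def map_map comp_def by (simp only:)
  qed
  then show ?thesis
    unfolding reading_def far_eastern_def map_concat map_map comp_def dual_concat rev_map rev_rev_ident
    by (intro arg_cong[where f = concat] map_cong refl) (auto simp del: upt_Suc)
qed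

lemma reading_extremal_connected:
  obtains ps where "fold knuth_move ps (reading lam (T_high lam)) = dual n (reading lam (T_low n lam))"
proof -
  have "mset (reading lam (T_high lam)) = mset (dual n (reading lam (T_low n lam)))"
    unfolding reading_T_high dual_reading_T_low rev_map[symmetric] mset_concat_rev ..
  then have "knuth_step\<^sup>*\<^sup>* (reading lam (T_high lam)) (dual n (reading lam (T_low n lam)))"
    unfolding reading_T_high dual_reading_T_low by (intro yamanouchi_connected yamanouchi_columns)
  then show thesis using knuth_steps_moves that by blast
qed

section \<open>The involution\<close>

text \<open>Partners correspond under the composite of Knuth moves given by \<open>ps\<close>, followed by duality.\<close>

definition partner :: "nat list \<Rightarrow> tableau \<Rightarrow> tableau \<Rightarrow> bool" where
  "partner ps T T' \<longleftrightarrow> T \<in> tableaux n lam \<and> T' \<in> tableaux n lam \<and>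
     dual n (reading lam T') = fold knuth_move ps (reading lam T)"

lemma partner_unique:
  assumes "partner ps T T'" "partner ps T T''"
  shows "T' = T''"
proof -
  have T: "T' \<in> tableaux n lam" "T'' \<in> tableaux n lam"
    and "dual n (reading lam T') = dual n (reading lam T'')"
    using assms by (simp_all add: partner_def)
  then have "dual n (dual n (reading lam T')) = dual n (dual n (reading lam T''))" by simp
  then have "reading lam T' = reading lam T''"
    unfolding T[THEN set_reading, THEN dual_dual] .
  with T show ?thesis by (rule reading_inj)
qed

lemma set_knuth_moves_reading:
  "T \<in> tableaux n lam \<Longrightarrow> set (fold knuth_move ps (reading lam T)) \<subseteq> {1..n + 1}"
  using set_reading mset_knuth_moves by (metis mset_eq_setD)

text \<open>Knuth moves commute with \<open>f\<^sub>i\<close> and duality exchanges \<open>f\<^sub>i\<close> with \<open>e\<close> of index \<open>n + 1 - i\<close>, so partners are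
matched again after one step; the next two lemmas give the same for \<open>e\<^sub>i\<close> on the left and for the
value 0.\<close>

lemma partner_ftilde:
  assumes TT': "partner ps T T'" and i: "i \<in> {1..n}" and S: "ftilde lam i T = Some S"
  shows "\<exists>S'. etilde lam (n + 1 - i) T' = Some S' \<and> partner ps S S'"
proof -
  let ?k = "fold knuth_move ps"
  have T: "T \<in> tableaux n lam" "T' \<in> tableaux n lam"
    "dual n (reading lam T') = ?k (reading lam T)" using TT' by (auto simp: partner_def)
  have S_tab: "S \<in> tableaux n lam" using ftilde_tableau[OF T(1) i S] .
  have "word_f i (dual n (reading lam T')) = Some (?k (reading lam S))"
    using reading_ftilde[OF S] by (simp add: T(3) word_f_knuth_moves)
  then have "word_f (n + 1 - i) (dual n (?k (reading lam S))) = Some (dual n (dual n (reading lam T')))"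
    by (intro word_f_dual i set_dual set_reading T)
  then have "word_f (n + 1 - i) (dual n (?k (reading lam S))) = Some (reading lam T')"
    using dual_dual[OF set_reading[OF T(2)]] by simp
  then obtain S' where S': "etilde lam (n + 1 - i) T' = Some S'"
    "reading lam S' = dual n (?k (reading lam S))"
    by (rule word_f_into_readingE)
  have "n + 1 - i \<in> {1..n}" using i by auto
  then have "S' \<in> tableaux n lam" using etilde_tableau[OF T(2) _ S'(1)] by blast
  moreover have "dual n (reading lam S') = ?k (reading lam S)"
    unfolding S'(2) by (intro dual_dual set_knuth_moves_reading S_tab)
  ultimately show ?thesis using S'(1) S_tab by (auto simp: partner_def)
qed

lemma partner_etilde:
  assumes TT': "partner ps T T'" and i: "i \<in> {1..n}" and S: "etilde lam i T = Some S"
  shows "\<exists>S'. ftilde lam (n + 1 - i) T' = Some S' \<and> partner ps S S'"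
proof -
  let ?k = "fold knuth_move ps"
  have T: "T \<in> tableaux n lam" "T' \<in> tableaux n lam"
    "dual n (reading lam T') = ?k (reading lam T)" using TT' by (auto simp: partner_def)
  have S_tab: "S \<in> tableaux n lam" using etilde_tableau[OF T(1) i S] .
  have "word_f i (?k (reading lam S)) = Some (dual n (reading lam T'))"
    using reading_etilde[OF S] by (simp add: T(3) word_f_knuth_moves)
  then have "word_f (n + 1 - i) (dual n (dual n (reading lam T'))) = Some (dual n (?k (reading lam S)))"
    by (intro word_f_dual i set_knuth_moves_reading S_tab)
  then have "word_f (n + 1 - i) (reading lam T') = Some (dual n (?k (reading lam S)))"
    using dual_dual[OF set_reading[OF T(2)]] by simp
  then obtain S' where S': "ftilde lam (n + 1 - i) T' = Some S'"
    "reading lam S' = dual n (?k (reading lam S))"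
    by (rule word_f_readingE)
  have "n + 1 - i \<in> {1..n}" using i by auto
  then have "S' \<in> tableaux n lam" using ftilde_tableau[OF T(2) _ S'(1)] by blast
  moreover have "dual n (reading lam S') = ?k (reading lam S)"
    unfolding S'(2) by (intro dual_dual set_knuth_moves_reading S_tab)
  ultimately show ?thesis using S'(1) S_tab by (auto simp: partner_def)
qed

lemma partner_ftilde_None:
  assumes TT': "partner ps T T'" and i: "i \<in> {1..n}" and None: "ftilde lam i T = None"
  shows "etilde lam (n + 1 - i) T' = None"
proof (rule ccontr)
  let ?k = "fold knuth_move ps"
  assume "etilde lam (n + 1 - i) T' \<noteq> None"
  then obtain S' where S': "etilde lam (n + 1 - i) T' = Some S'" by auto
  have T': "T' \<in> tableaux n lam" "dual n (reading lam T') = ?k (reading lam T)"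
    using TT' by (auto simp: partner_def)
  have i': "n + 1 - i \<in> {1..n}" "n + 1 - (n + 1 - i) = i" using i by auto
  have "word_f i (dual n (reading lam T')) = Some (dual n (reading lam S'))"
    using word_f_dual[OF i'(1) set_reading[OF etilde_tableau[OF T'(1) i'(1) S']] reading_etilde[OF S']]
    unfolding i'(2) .
  then have "word_f i (reading lam T) \<noteq> None" by (auto simp: T' word_f_knuth_moves)
  with None show False by (simp add: ftilde_eq_None_iff)
qed

context
  fixes ps :: "nat list"
  assumes ps: "fold knuth_move ps (reading lam (T_high lam)) = dual n (reading lam (T_low n lam))"
begin

lemma partner_high_low: "partner ps (T_high lam) (T_low n lam)"
  using ps T_high_tableau T_low_tableau by (simp add: partner_def)

lemma partner_exists: "T \<in> tableaux n lam \<Longrightarrow> \<exists>T'. partner ps T T'"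
  by (induction rule: tableau_induct) (use partner_high_low partner_ftilde in blast)+

text \<open>The partner \<open>X\<close> of the lowest tableau has the same letters as the highest tableau: the multiset of letters is
preserved by Knuth moves and complemented by duality. No entry of \<open>X\<close> is smaller than its row number, and the
sum of the entries leaves no room for a larger one.\<close>

lemma partner_low_high: "partner ps (T_low n lam) (T_high lam)"
proof -
  obtain X where X: "partner ps (T_low n lam) X" using partner_exists T_low_tableau by blast
  then have X_tab: "X \<in> tableaux n lam" by (simp add: partner_def)
  have "mset (reading lam X) = mset (dual n (dual n (reading lam X)))"
    using dual_dual[OF set_reading[OF X_tab]] by simp
  also have "\<dots> = mset (dual n (reading lam (T_low n lam)))"
    using X unfolding partner_def mset_dual[of _ "dual _ _"] by (simp add: mset_dual mset_knuth_moves)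
  also have "\<dots> = mset (reading lam (T_high lam))"
    unfolding ps[symmetric] by (rule mset_knuth_moves)
  finally have "sum_list (reading lam (T_high lam)) = sum_list (reading lam X)"
    by (metis sum_mset_sum_list)
  then have sums: "sum (T_high lam) (diagram lam) = sum X (diagram lam)"
    unfolding reading_def sum_list_distinct_conv_sum_set[OF distinct_far_eastern] set_far_eastern .
  have "X x = T_high lam x" for x
  proof (cases "x \<in> diagram lam")
    case True
    have "finite (diagram lam)" using set_far_eastern finite_set by metis
    moreover have "T_high lam x \<le> X x" if "x \<in> diagram lam" for x
      using that row_le_entry[OF X_tab, of "fst x" "snd x"] by (auto simp: T_high_def split: prod.splits)
    ultimately show ?thesis using sum_mono_inv[OF sums] True by metis
  next
    case False
    then show ?thesis
      using tableauD(2)[OF X_tab, of "fst x" "snd x"] tableauD(2)[OF T_high_tableau, of "fst x" "snd x"]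
      by simp
  qed
  then have "X = T_high lam" by (rule ext)
  with X show ?thesis by simp
qed

text \<open>By induction along the crystal: from \<open>partner ps T' T\<close>, applying \<open>e\<close> of index \<open>n + 1 - i\<close> to
\<open>T'\<close> forces \<open>f\<^sub>i\<close> on \<open>T\<close>, and uniqueness of partners identifies the results.\<close>

lemma partner_sym: "partner ps T T' \<Longrightarrow> partner ps T' T"
proof -
  assume TT': "partner ps T T'"
  then have "T \<in> tableaux n lam" by (simp add: partner_def)
  then have "\<forall>T'. partner ps T T' \<longrightarrow> partner ps T' T"
  proof (induction rule: tableau_induct)
    case high
    then show ?case using partner_unique[OF partner_high_low] partner_low_high by blast
  next
    case (ftilde T i S)
    show ?case
    proof (intro allI impI)
      fix S' assume SS': "partner ps S S'"
      obtain T' where TT': "partner ps T T'" using partner_exists ftilde.hyps(1) by blast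
      obtain S'' where S'': "etilde lam (n + 1 - i) T' = Some S''" "partner ps S S''"
        using partner_ftilde[OF TT'] ftilde.hyps by blast
      have i': "n + 1 - i \<in> {1..n}" "n + 1 - (n + 1 - i) = i" using ftilde.hyps(2) by auto
      have "S'' = S'" using partner_unique[OF S''(2) SS'] .
      moreover have "partner ps T' T" using ftilde.IH TT' by blast
      ultimately have "partner ps S' S"
        using partner_etilde[OF _ i'(1)] S''(1) ftilde.hyps(3) unfolding i'(2) by fastforce
      then show "partner ps S' S" .
    qed
  qed
  then show ?thesis using TT' by blast
qed

lemma partner_ftildes:
  assumes "partner ps T T'" "set is \<subseteq> {1..n}" and \<rho>: "\<And>T T'. partner ps T T' \<Longrightarrow> \<rho> T = T'"
  shows "map_option \<rho> (ftildes lam is T) = etildes lam (map (\<lambda>i. n + 1 - i) is) T'"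
  using assms(1,2)
proof (induction "is" arbitrary: T T')
  case Nil
  then show ?case using \<rho> by (simp add: ftildes_def etildes_def)
next
  case (Cons i "is")
  have i: "i \<in> {1..n}" using Cons.prems by simp
  have none: "fold (\<lambda>i X. Option.bind X (g i)) js None = None"
    for g :: "nat \<Rightarrow> tableau \<Rightarrow> tableau option" and js
    by (induction js) auto
  show ?case
  proof (cases "ftilde lam i T")
    case None
    then show ?thesis
      using partner_ftilde_None[OF Cons.prems(1) i] by (simp add: ftildes_def etildes_def none)
  next
    case (Some S)
    then obtain S' where S': "etilde lam (n + 1 - i) T' = Some S'" "partner ps S S'"
      using partner_ftilde[OF Cons.prems(1) i] by blast
    then show ?thesis
      using Cons.IH[OF S'(2)] Cons.prems(2) Some by (simp add: ftildes_def etildes_def)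
  qed
qed

end

end

theorem proposition2p14:
  fixes n :: nat and lam :: "nat \<Rightarrow> real"
  assumes "lam \<in> Pplus n"
  shows "\<exists>\<rho> :: tableau \<Rightarrow> tableau.
           (\<forall>T \<in> tableaux n lam. \<rho> T \<in> tableaux n lam \<and> \<rho> (\<rho> T) = T) \<and>
           (\<forall>is. set is \<subseteq> {1..n} \<longrightarrow>
              map_option \<rho> (ftildes lam is (T_high lam)) =
              etildes lam (map (\<lambda>i. n + 1 - i) is) (T_low n lam))"
proof -
  interpret dominant_weight n lam using assms by unfold_locales
  obtain ps where ps: "fold knuth_move ps (reading lam (T_high lam)) = dual n (reading lam (T_low n lam))"
    by (rule reading_extremal_connected)
  define \<rho> where "\<rho> T = (THE T'. partner ps T T')" for T
  have \<rho>: "\<rho> T = T'" if "partner ps T T'" for T T'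
    unfolding \<rho>_def using that partner_unique by (intro the_equality)
  have "\<rho> T \<in> tableaux n lam \<and> \<rho> (\<rho> T) = T" if T: "T \<in> tableaux n lam" for T
  proof -
    obtain T' where T': "partner ps T T'" using partner_exists[OF ps T] by blast
    then show ?thesis using \<rho>[OF T'] \<rho>[OF partner_sym[OF ps T']] by (simp add: partner_def)
  qed
  then show ?thesis using partner_ftildes[OF ps partner_high_low[OF ps]] \<rho> by blast
qed

end
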